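(* Let $p$ be a prime number, let $n\ge 1$ be an integer, and let $G$ be an extraspecial $p$-group of order $p^{1+2n}$ (of either of the two isomorphism types $p_+^{1+2n}$, $p_-^{1+2n}$). Then $$\mathrm{crd}_{\mathbb{C}}(G)\le pn .$$
   Context: For an integer $m\ge 0$, the Cremona group $\mathrm{Cr}_{\mathbb{C}}(m)$ is the group of birational automorphisms of $\mathbb{P}^m_{\mathbb{C}}$ over $\mathbb{C}$, i.e. $\mathrm{Cr}_{\mathbb{C}}(m)=\mathrm{Aut}(\mathbb{C}(t_1,\ldots,t_m)/\mathbb{C})$. For a finite group $G$, the Cremona dimension $\mathrm{crd}_{\mathbb{C}}(G)$ is the smallest $m$ such that $G$ is isomorphic to a subgroup of $\mathrm{Cr}_{\mathbb{C}}(m)$. A finite $p$-group $G$ is extraspecial if its center $Z(G)$ is cyclic of order $p$, coincides with the commutator subgroup $[G,G]$, and $G/Z(G)$ is an elementary abelian $p$-group; then $G/Z(G)\cong(\mathbb{Z}/p\mathbb{Z})^{2n}$ for some $n\ge 1$ and $|G|=p^{1+2n}$. For each $p$ and $n$ there are exactly two isomorphism classes of such groups, denoted $p_+^{1+2n}$ and $p_-^{1+2n}$: if $p$ is odd, $p_+^{1+2n}$ has exponent $p$ and $p_-^{1+2n}$ has exponent $p^2$; if $p=2$, $2_+^{1+2n}$ is the central product of $n$ copies of the dihedral group of order $8$, and $2_-^{1+2n}$ is the central product of the quaternion group $Q_8$ and $n-1$ copies of the dihedral group of order $8$. *)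

theory Defs
  imports
    "HOL-Algebra.Algebra"
    "HOL-Algebra.Algebraic_Closure_Type"
    "HOL-Computational_Algebra.Fraction_Field"
    "HOL-Library.Poly_Mapping"
    "HOL-Library.Extended_Nat"
begin

hide_const (open) Polynomial.order

text \<open>
  A polynomial in the variables \<open>t\<^sub>0, t\<^sub>1, \<dots>\<close> is a finitely supported map from monomials to
  coefficients, a monomial being a finitely supported map from variable indices to exponents.
  The number of variables has to range over all naturals inside a formula, so
  \<open>\<complex>(t\<^sub>0, \<dots>, t\<^bsub>m-1\<^esub>)\<close> is carved out as a subfield of the fraction field in countably
  many variables.
\<close>

type_synonym cpoly = "(nat \<Rightarrow>\<^sub>0 nat) \<Rightarrow>\<^sub>0 complex"
type_synonym cratfun = "cpoly fract"

definition vars :: "cpoly \<Rightarrow> nat set" where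
  "vars P = (\<Union>u\<in>Poly_Mapping.keys P. Poly_Mapping.keys u)"

definition ratfuns :: "nat \<Rightarrow> cratfun set" where
  "ratfuns m = {Fract P Q | P Q. vars P \<subseteq> {..<m} \<and> vars Q \<subseteq> {..<m} \<and> Q \<noteq> 0}"

definition ratfun_field :: "nat \<Rightarrow> cratfun ring" where
  "ratfun_field m = ring_of_type_algebra \<lparr>carrier := ratfuns m\<rparr>"

definition const_ratfun :: "complex \<Rightarrow> cratfun" where
  "const_ratfun c = Fract (Poly_Mapping.single 0 c) 1"

text \<open>
  \<open>Aut(L/k)\<close> for a subset \<open>k\<close> of a field \<open>L\<close>. As in \<^const>\<open>AutoGroup\<close>, automorphisms are
  functions extensional on the carrier, multiplied by composition.
\<close>

definition aut_over :: "('a, 'b) ring_scheme \<Rightarrow> 'a set \<Rightarrow> ('a \<Rightarrow> 'a) set" where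
  "aut_over L k = {f \<in> ring_iso L L \<inter> extensional (carrier L). \<forall>c\<in>k. f c = c}"

definition AutGroup_over :: "('a, 'b) ring_scheme \<Rightarrow> 'a set \<Rightarrow> ('a \<Rightarrow> 'a) monoid" where
  "AutGroup_over L k = BijGroup (carrier L) \<lparr>carrier := aut_over L k\<rparr>"

definition Cremona :: "nat \<Rightarrow> (cratfun \<Rightarrow> cratfun) monoid" where
  "Cremona m = AutGroup_over (ratfun_field m) (range const_ratfun)"

text \<open>
  The infimum in \<^typ>\<open>enat\<close> is the minimum when some \<open>m\<close> exists and \<open>\<infinity>\<close> otherwise, so a finite
  upper bound asserts in particular that \<open>G\<close> does embed into some Cremona group.
\<close>

definition crd :: "('a, 'b) monoid_scheme \<Rightarrow> enat" where
  "crd G = Inf {enat m | m. \<exists>H. subgroup H (Cremona m) \<and> G \<cong> (Cremona m)\<lparr>carrier := H\<rparr>}"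

definition center :: "('a, 'b) monoid_scheme \<Rightarrow> 'a set" where
  "center G = {z \<in> carrier G. \<forall>g\<in>carrier G. z \<otimes>\<^bsub>G\<^esub> g = g \<otimes>\<^bsub>G\<^esub> z}"

definition finite_p_group :: "nat \<Rightarrow> ('a, 'b) monoid_scheme \<Rightarrow> bool" where
  "finite_p_group p G \<longleftrightarrow> group G \<and> finite (carrier G) \<and> (\<exists>k. order G = p ^ k)"

definition elementary_abelian :: "nat \<Rightarrow> ('a, 'b) monoid_scheme \<Rightarrow> bool" where
  "elementary_abelian p G \<longleftrightarrow> comm_group G \<and> (\<forall>x\<in>carrier G. x [^]\<^bsub>G\<^esub> p = \<one>\<^bsub>G\<^esub>)"

definition extraspecial :: "nat \<Rightarrow> ('a, 'b) monoid_scheme \<Rightarrow> bool" where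
  "extraspecial p G \<longleftrightarrow>
     finite_p_group p G \<and>
     cyclic_group (G\<lparr>carrier := center G\<rparr>) \<and> card (center G) = p \<and>
     center G = derived G (carrier G) \<and>
     elementary_abelian p (G Mod center G)"

lemma vars_add: "vars (P + Q) \<subseteq> vars P \<union> vars Q"
  using keys_add[of P Q] by (auto simp: vars_def)

lemma vars_uminus: "vars (- P) = vars P"
proof -
  have "Poly_Mapping.keys (- P) = Poly_Mapping.keys P"
    by transfer auto
  thus ?thesis by (simp add: vars_def)
qed

lemma vars_mult: "vars (P * Q) \<subseteq> vars P \<union> vars Q"
proof
  fix i assume "i \<in> vars (P * Q)"
  then obtain u where u: "u \<in> Poly_Mapping.keys (P * Q)" "i \<in> Poly_Mapping.keys u"
    by (auto simp: vars_def)
  then obtain a b where "u = a + b" "a \<in> Poly_Mapping.keys P" "b \<in> Poly_Mapping.keys Q"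
    using keys_mult[of P Q] by blast
  thus "i \<in> vars P \<union> vars Q"
    using u(2) keys_add[of a b] by (auto simp: vars_def)
qed

lemma vars_zero [simp]: "vars 0 = {}"
  by (simp add: vars_def)

lemma vars_one [simp]: "vars 1 = {}"
  by (simp add: vars_def)

lemma vars_const [simp]: "vars (Poly_Mapping.single 0 c) = {}"
  by (simp add: vars_def)

lemma const_ratfun_in_ratfuns: "const_ratfun c \<in> ratfuns m"
  unfolding const_ratfun_def ratfuns_def by (rule CollectI) (intro exI conjI refl, auto)

lemma ratfuns_subfield: "subfield (ratfuns m) (ring_of_type_algebra :: cratfun ring)"
proof -
  let ?R = "ring_of_type_algebra :: cratfun ring"
  interpret R: field ?R by (rule field_from_type_algebra)
  have car: "carrier ?R = UNIV" and mult: "x \<otimes>\<^bsub>?R\<^esub> y = x * y" and add: "x \<oplus>\<^bsub>?R\<^esub> y = x + y"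
    and one: "\<one>\<^bsub>?R\<^esub> = 1" and zero: "\<zero>\<^bsub>?R\<^esub> = 0" for x y
    by (simp_all add: ring_of_type_algebra_def)
  have I: "Fract P Q \<in> ratfuns m" if "vars P \<subseteq> {..<m}" "vars Q \<subseteq> {..<m}" "Q \<noteq> 0" for P Q
    using that by (auto simp: ratfuns_def)
  have um: "\<ominus>\<^bsub>?R\<^esub> x = - x" for x
    by (rule R.minus_equality) (simp_all add: car add zero)
  have iv: "inv\<^bsub>?R\<^esub> x = inverse x" if "x \<noteq> 0" for x
    by (rule R.comm_inv_char) (use that in \<open>simp_all add: car mult one\<close>)
  show ?thesis
  proof (rule R.subfieldI')
    show "subring (ratfuns m) ?R"
    proof (rule R.subringI)
      show "\<one>\<^bsub>?R\<^esub> \<in> ratfuns m"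
        using I[of 1 1] by (simp add: one One_fract_def)
    next
      fix x assume "x \<in> ratfuns m"
      then obtain P Q where "x = Fract P Q" "vars P \<subseteq> {..<m}" "vars Q \<subseteq> {..<m}" "Q \<noteq> 0"
        by (auto simp: ratfuns_def)
      thus "\<ominus>\<^bsub>?R\<^esub> x \<in> ratfuns m"
        using I[of "- P" Q] by (simp add: um vars_uminus)
    next
      fix x y assume "x \<in> ratfuns m" "y \<in> ratfuns m"
      then obtain P Q P' Q' where *: "x = Fract P Q" "vars P \<subseteq> {..<m}" "vars Q \<subseteq> {..<m}" "Q \<noteq> 0"
         "y = Fract P' Q'" "vars P' \<subseteq> {..<m}" "vars Q' \<subseteq> {..<m}" "Q' \<noteq> 0"
        by (auto simp: ratfuns_def)
      have v: "vars (A * B) \<subseteq> {..<m}" if "vars A \<subseteq> {..<m}" "vars B \<subseteq> {..<m}" for A B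
        using vars_mult[of A B] that by blast
      have w: "vars (A + B) \<subseteq> {..<m}" if "vars A \<subseteq> {..<m}" "vars B \<subseteq> {..<m}" for A B
        using vars_add[of A B] that by blast
      show "x \<otimes>\<^bsub>?R\<^esub> y \<in> ratfuns m"
        unfolding mult *(1,5) mult_fract by (rule I) (use * v in simp_all)
      show "x \<oplus>\<^bsub>?R\<^esub> y \<in> ratfuns m"
        unfolding add *(1,5) add_fract[OF *(4,8)] by (rule I) (use * v w in simp_all)
    qed (simp add: car)
  next
    fix x assume "x \<in> ratfuns m - {\<zero>\<^bsub>?R\<^esub>}"
    then obtain P Q where *: "x = Fract P Q" "vars P \<subseteq> {..<m}" "vars Q \<subseteq> {..<m}" "Q \<noteq> 0" "x \<noteq> 0"
      by (auto simp: ratfuns_def zero)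
    moreover from * have "P \<noteq> 0" by (auto simp: fract_collapse)
    ultimately show "inv\<^bsub>?R\<^esub> x \<in> ratfuns m"
      by (auto simp: iv intro!: I)
  qed
qed

lemma ratfun_field_is_field: "field (ratfun_field m)"
  unfolding ratfun_field_def
  by (rule ring.subfield_iff(2)[OF ring_from_type_algebra ratfuns_subfield])

lemma ring_iso_compose_restrict:
  assumes "f \<in> ring_iso L L" "g \<in> ring_iso L L" "ring L"
  shows "compose (carrier L) f g \<in> ring_iso L L"
proof -
  interpret L: ring L by fact
  have h: "f \<in> ring_hom L L" "g \<in> ring_hom L L"
    "bij_betw f (carrier L) (carrier L)" "bij_betw g (carrier L) (carrier L)"
    using assms by (auto simp: ring_iso_def)
  have "compose (carrier L) f g \<in> ring_hom L L"
    by (rule ring_hom_memI)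
       (use h in \<open>auto simp: compose_def ring_hom_closed ring_hom_mult ring_hom_add ring_hom_one\<close>)
  thus ?thesis
    using bij_betw_compose[OF h(4) h(3)] by (simp add: ring_iso_def)
qed

lemma AutGroup_over_group:
  assumes "ring L" "k \<subseteq> carrier L"
  shows "group (AutGroup_over L k)"
proof -
  interpret L: ring L by fact
  let ?S = "carrier L"
  have sub: "aut_over L k \<subseteq> Bij ?S"
    by (auto simp: aut_over_def Bij_def ring_iso_def)
  have "subgroup (aut_over L k) (BijGroup ?S)"
  proof (rule subgroup.intro)
    show "aut_over L k \<subseteq> carrier (BijGroup ?S)" using sub by (simp add: BijGroup_def)
  next
    fix f g assume fg: "f \<in> aut_over L k" "g \<in> aut_over L k"
    have "compose ?S f g \<in> aut_over L k"
      using fg assms ring_iso_compose_restrict[of f L g]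
      by (auto simp: aut_over_def compose_def)
    thus "f \<otimes>\<^bsub>BijGroup ?S\<^esub> g \<in> aut_over L k"
      using fg sub by (auto simp: BijGroup_def)
  next
    have "(\<lambda>x\<in>?S. x) \<in> ring_hom L L" by (rule ring_hom_memI) auto
    thus "\<one>\<^bsub>BijGroup ?S\<^esub> \<in> aut_over L k"
      using assms by (auto simp: BijGroup_def aut_over_def ring_iso_def bij_betw_def inj_on_def)
  next
    fix f assume f: "f \<in> aut_over L k"
    hence fB: "f \<in> Bij ?S" and fi: "f \<in> ring_iso L L" and fk: "\<And>c. c \<in> k \<Longrightarrow> f c = c"
      using sub by (auto simp: aut_over_def)
    have "inv_into ?S f \<in> ring_iso L L"
      using ring_iso_set_sym[OF assms(1) fi] .
    hence "(\<lambda>x\<in>?S. inv_into ?S f x) \<in> ring_iso L L"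
      by (auto simp: ring_iso_def ring_hom_def cong: bij_betw_cong)
    moreover have "inv_into ?S f c = c" if "c \<in> k" for c
    proof -
      have "inj_on f ?S" using fi by (simp add: ring_iso_def bij_betw_def)
      hence "inv_into ?S f (f c) = c" using assms(2) that by (intro inv_into_f_f) auto
      thus ?thesis by (simp add: fk[OF that])
    qed
    ultimately show "inv\<^bsub>BijGroup ?S\<^esub> f \<in> aut_over L k"
      using assms(2) by (auto simp: inv_BijGroup[OF fB] aut_over_def)
  qed
  thus ?thesis
    unfolding AutGroup_over_def
    by (rule subgroup.subgroup_is_group) (rule group_BijGroup)
qed

lemma Cremona_group: "group (Cremona m)"
proof -
  have "range const_ratfun \<subseteq> carrier (ratfun_field m)"
    using const_ratfun_in_ratfuns by (auto simp: ratfun_field_def)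
  thus ?thesis
    unfolding Cremona_def
    by (intro AutGroup_over_group field.is_ring ratfun_field_is_field)
qed

end

theory Submission
  imports Defs
begin

text \<open>
  A faithful irreducible representation of \<open>G\<close> has dimension \<open>p\<^sup>n\<close>, so a linear action is in
  general too expensive. Geometrically, however, \<open>G\<close> is a central product of \<open>n\<close> groups of order
  \<open>p\<^sup>3\<close>, each with a faithful representation \<open>V\<^sub>i\<close> of dimension \<open>p\<close>. The elementary abelian quotient
  \<open>G / Z(G)\<close> acts on \<open>\<P>(V\<^sub>1) \<times> \<dots> \<times> \<P>(V\<^sub>n)\<close> and \<open>G\<close> itself acts on the cone over
  the Segre embedding of this product into \<open>\<P>(V\<^sub>1 \<otimes> \<dots> \<otimes> V\<^sub>n)\<close>. That cone is rational of
  dimension \<open>n (p - 1) + 1 \<le> p n\<close>, and the centre acts faithfully by scalars on its rulings, so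
  that the whole action is faithful.

  In coordinates this needs very little of the structure of \<open>G\<close>: a function \<open>\<theta>\<close> that extends a
  faithful character of the centre to \<open>G\<close> and whose failure to be multiplicative is
  \<open>\<theta> (g h) = \<theta> g \<cdot> \<theta> h \<cdot> (\<Prod>i<n. \<gamma>\<^sub>i(g) ^ b\<^sub>i(h))\<close> with characters \<open>\<gamma>\<^sub>i\<close> of order
  dividing \<open>p\<close> and homomorphisms \<open>b\<^sub>i\<close> to the integers modulo \<open>p\<close>. In other words, the class of
  the central extension, pushed into \<open>\<complex>\<^sup>*\<close>, is a sum of \<open>n\<close> cup products
  (\<open>splits_cocycle_exists\<close>). It is found by splitting off one hyperbolic pair \<open>x, y\<close> of the
  commutator form at a time: the centralizer of the pair is again of the same kind, of index
  \<open>p\<^sup>2\<close>.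

  Given such data, let \<open>u\<^sub>i\<^sub>j\<close> (\<open>j\<close> modulo \<open>p\<close>, \<open>u\<^sub>i\<^sub>0 = 1\<close>) be affine coordinates on the
  \<open>i\<close>-th projective space and \<open>t\<close> a fibre coordinate, and let \<open>g\<close> act by
  \<open>u\<^sub>i\<^sub>j \<mapsto> \<gamma>\<^sub>i(g)\<^sup>j u\<^sub>i\<^sub>,\<^sub>j\<^sub>+\<^sub>b / u\<^sub>i\<^sub>,\<^sub>b\<close> with \<open>b = b\<^sub>i(g)\<close> and
  \<open>t \<mapsto> \<theta>(g) t \<cdot> \<Prod>\<^sub>i u\<^sub>i\<^sub>,\<^sub>b\<close>. The cup product formula for \<open>\<theta>\<close> says exactly that
  this respects multiplication (\<open>crd_le_of_splits_cocycle\<close>). A family of substitutions that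
  composes like a group consists of field automorphisms (\<open>crd_le_of_substitution_action\<close>).
\<close>

section \<open>Substitution into rational functions\<close>

definition ratvar :: "nat \<Rightarrow> cratfun" where
  "ratvar l = Fract (Poly_Mapping.single (Poly_Mapping.single l 1) 1) 1"

definition monomial_subst :: "(nat \<Rightarrow> cratfun) \<Rightarrow> (nat \<Rightarrow>\<^sub>0 nat) \<Rightarrow> cratfun" where
  "monomial_subst s u = (\<Prod>l\<in>Poly_Mapping.keys u. s l ^ Poly_Mapping.lookup u l)"

definition poly_subst :: "(nat \<Rightarrow> cratfun) \<Rightarrow> cpoly \<Rightarrow> cratfun" where
  "poly_subst s P =
     (\<Sum>u\<in>Poly_Mapping.keys P. const_ratfun (Poly_Mapping.lookup P u) * monomial_subst s u)"

lemma const_ratfun_0 [simp]: "const_ratfun 0 = 0"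
  by (simp add: const_ratfun_def fract_collapse)

lemma const_ratfun_1 [simp]: "const_ratfun 1 = 1"
  by (simp add: const_ratfun_def fract_collapse)

lemma const_ratfun_add: "const_ratfun (a + b) = const_ratfun a + const_ratfun b"
  by (simp add: const_ratfun_def single_add)

lemma const_ratfun_mult: "const_ratfun (a * b) = const_ratfun a * const_ratfun b"
  by (simp add: const_ratfun_def mult_single)

lemma const_ratfun_eq_iff [simp]: "const_ratfun a = const_ratfun b \<longleftrightarrow> a = b"
proof
  assume "const_ratfun a = const_ratfun b"
  then have "Poly_Mapping.lookup (Poly_Mapping.single (0 :: nat \<Rightarrow>\<^sub>0 nat) a) 0 =
      Poly_Mapping.lookup (Poly_Mapping.single 0 b) 0"
    by (simp add: const_ratfun_def eq_fract)
  then show "a = b" by simp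
qed simp

lemma const_ratfun_prod: "const_ratfun (\<Prod>i\<in>A. f i) = (\<Prod>i\<in>A. const_ratfun (f i))"
  by (induction A rule: infinite_finite_induct) (simp_all add: const_ratfun_mult)

lemma ratvar_nonzero [simp]: "ratvar l \<noteq> 0"
proof -
  have "Poly_Mapping.single (Poly_Mapping.single l (1::nat)) (1::complex) \<noteq> 0"
    by (metis lookup_single_eq lookup_zero zero_neq_one)
  then show ?thesis by (simp add: ratvar_def Zero_fract_def eq_fract)
qed

text \<open>
  The products and sums above run over the support, which changes under addition. Any larger finite
  index set gives the same value, so that two polynomials can be handled over a common one.
\<close>

lemma monomial_subst_superset:
  assumes "finite A" "Poly_Mapping.keys u \<subseteq> A"
  shows "monomial_subst s u = (\<Prod>l\<in>A. s l ^ Poly_Mapping.lookup u l)"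
  unfolding monomial_subst_def
  by (rule prod.mono_neutral_left) (use assms in \<open>auto simp: in_keys_iff\<close>)

lemma monomial_subst_0 [simp]: "monomial_subst s 0 = 1"
  by (simp add: monomial_subst_def)

lemma monomial_subst_add: "monomial_subst s (u + v) = monomial_subst s u * monomial_subst s v"
proof -
  let ?A = "Poly_Mapping.keys u \<union> Poly_Mapping.keys v"
  have "monomial_subst s (u + v) = (\<Prod>l\<in>?A. s l ^ Poly_Mapping.lookup (u + v) l)"
    using keys_add[of u v] by (intro monomial_subst_superset) auto
  also have "\<dots> = (\<Prod>l\<in>?A. s l ^ Poly_Mapping.lookup u l) * (\<Prod>l\<in>?A. s l ^ Poly_Mapping.lookup v l)"
    by (simp add: lookup_add power_add prod.distrib)
  also have "\<dots> = monomial_subst s u * monomial_subst s v"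
    by (simp add: monomial_subst_superset[of ?A])
  finally show ?thesis .
qed

lemma poly_subst_superset:
  assumes "finite A" "Poly_Mapping.keys P \<subseteq> A"
  shows "poly_subst s P =
    (\<Sum>u\<in>A. const_ratfun (Poly_Mapping.lookup P u) * monomial_subst s u)"
  unfolding poly_subst_def
  by (rule sum.mono_neutral_left) (use assms in \<open>auto simp: in_keys_iff\<close>)

lemma poly_subst_single:
  "poly_subst s (Poly_Mapping.single u c) = const_ratfun c * monomial_subst s u"
  by (subst poly_subst_superset[of "{u}"]) auto

lemma poly_subst_0 [simp]: "poly_subst s 0 = 0"
  by (simp add: poly_subst_def)

lemma poly_subst_1 [simp]: "poly_subst s 1 = 1"
  using poly_subst_single[of s 0 1] by simp

lemma poly_subst_const [simp]: "poly_subst s (Poly_Mapping.single 0 c) = const_ratfun c"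
  by (simp add: poly_subst_single)

lemma poly_subst_var [simp]:
  "poly_subst s (Poly_Mapping.single (Poly_Mapping.single l 1) 1) = s l"
  by (simp add: poly_subst_single monomial_subst_def)

lemma poly_subst_add: "poly_subst s (P + Q) = poly_subst s P + poly_subst s Q"
proof -
  let ?A = "Poly_Mapping.keys P \<union> Poly_Mapping.keys Q"
  have "poly_subst s (P + Q) =
      (\<Sum>u\<in>?A. const_ratfun (Poly_Mapping.lookup (P + Q) u) * monomial_subst s u)"
    using keys_add[of P Q] by (intro poly_subst_superset) auto
  also have "\<dots> = poly_subst s P + poly_subst s Q"
    by (simp add: poly_subst_superset[of ?A] lookup_add const_ratfun_add distrib_right sum.distrib)
  finally show ?thesis .
qed

lemma poly_subst_sum: "poly_subst s (\<Sum>i\<in>A. P i) = (\<Sum>i\<in>A. poly_subst s (P i))"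
  by (induction A rule: infinite_finite_induct) (simp_all add: poly_subst_add)

lemma cpoly_sum_singles:
  "P = (\<Sum>u\<in>Poly_Mapping.keys P. Poly_Mapping.single u (Poly_Mapping.lookup P u))" for P :: cpoly
proof (rule poly_mapping_eqI)
  fix v
  show "Poly_Mapping.lookup P v = Poly_Mapping.lookup
      (\<Sum>u\<in>Poly_Mapping.keys P. Poly_Mapping.single u (Poly_Mapping.lookup P u)) v"
    by (simp add: lookup_sum lookup_single when_def sum.If_cases Int_def in_keys_iff)
qed

lemma poly_subst_mult: "poly_subst s (P * Q) = poly_subst s P * poly_subst s Q"
proof -
  have "P * Q = (\<Sum>u\<in>Poly_Mapping.keys P. \<Sum>v\<in>Poly_Mapping.keys Q.
      Poly_Mapping.single (u + v) (Poly_Mapping.lookup P u * Poly_Mapping.lookup Q v))"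
    by (subst (1) cpoly_sum_singles[of P], subst (1) cpoly_sum_singles[of Q])
       (simp add: sum_product mult_single)
  then have "poly_subst s (P * Q) = (\<Sum>u\<in>Poly_Mapping.keys P. \<Sum>v\<in>Poly_Mapping.keys Q.
      (const_ratfun (Poly_Mapping.lookup P u) * monomial_subst s u) *
      (const_ratfun (Poly_Mapping.lookup Q v) * monomial_subst s v))"
    by (simp add: poly_subst_sum poly_subst_single const_ratfun_mult monomial_subst_add ac_simps)
  then show ?thesis
    by (simp add: poly_subst_def sum_product)
qed

lemma monomial_subst_ratvar: "monomial_subst ratvar u = Fract (Poly_Mapping.single u 1) 1"
proof -
  have pow: "ratvar l ^ k = Fract (Poly_Mapping.single (Poly_Mapping.single l k) 1) 1" for l k
    by (induction k) (simp_all add: ratvar_def mult_single One_fract_def flip: single_add)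
  have "(\<Prod>l\<in>A. Fract (Poly_Mapping.single (f l) 1) 1) =
      Fract (Poly_Mapping.single (\<Sum>l\<in>A. f l) 1) (1::cpoly)" if "finite A"
    for A and f :: "nat \<Rightarrow> nat \<Rightarrow>\<^sub>0 nat"
    using that by (induction A rule: finite_induct) (simp_all add: One_fract_def mult_single)
  moreover have "(\<Sum>l\<in>Poly_Mapping.keys u. Poly_Mapping.single l (Poly_Mapping.lookup u l)) = u"
    by (rule poly_mapping_eqI)
       (simp add: lookup_sum lookup_single when_def sum.If_cases Int_def in_keys_iff)
  ultimately show ?thesis
    by (simp add: monomial_subst_def pow)
qed

lemma poly_subst_ratvar: "poly_subst ratvar P = Fract P 1"
proof -
  have "(\<Sum>u\<in>A. Fract (f u) 1) = Fract (\<Sum>u\<in>A. f u) (1::cpoly)" if "finite A"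
    for A and f :: "(nat \<Rightarrow>\<^sub>0 nat) \<Rightarrow> cpoly"
    using that by (induction A rule: finite_induct) (simp_all add: Zero_fract_def)
  moreover have "const_ratfun c * monomial_subst ratvar u = Fract (Poly_Mapping.single u c) 1" for c u
    by (simp add: const_ratfun_def monomial_subst_ratvar mult_single)
  ultimately show ?thesis
    using cpoly_sum_singles[of P] by (simp add: poly_subst_def)
qed

text \<open>
  A substitution with values in a field need not extend to all fractions, since denominators may
  vanish. It does extend to a homomorphism on a local subring; this relation is the graph of that
  partial homomorphism. It is single-valued and closed under the field operations, which is enough
  to compute with compositions of substitutions before any of them is known to be injective.
\<close>

definition specializes :: "(nat \<Rightarrow> cratfun) \<Rightarrow> cratfun \<Rightarrow> cratfun \<Rightarrow> bool" where
  "specializes s x y \<longleftrightarrow>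
     (\<exists>P Q. poly_subst s Q \<noteq> 0 \<and> x = Fract P Q \<and> y = poly_subst s P / poly_subst s Q)"

lemma specializes_Fract:
  "poly_subst s Q \<noteq> 0 \<Longrightarrow> specializes s (Fract P Q) (poly_subst s P / poly_subst s Q)"
  by (auto simp: specializes_def)

lemma specializes_Fract_1: "specializes s (Fract P 1) (poly_subst s P)"
  using specializes_Fract[of s 1 P] by simp

lemma specializes_const: "specializes s (const_ratfun c) (const_ratfun c)"
  using specializes_Fract_1[of s "Poly_Mapping.single 0 c"] by (simp add: const_ratfun_def)

lemma specializes_ratvar: "specializes s (ratvar l) (s l)"
  using specializes_Fract_1[of s "Poly_Mapping.single (Poly_Mapping.single l 1) 1"]
  by (simp only: poly_subst_var ratvar_def)

text \<open>
  Cross-multiplying two representations of \<open>x\<close> and substituting gives the equality of the values.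
\<close>

lemma specializes_unique:
  assumes "specializes s x y" "specializes s x y'"
  shows "y = y'"
proof -
  obtain P Q P' Q' where *: "poly_subst s Q \<noteq> 0" "x = Fract P Q" "y = poly_subst s P / poly_subst s Q"
     "poly_subst s Q' \<noteq> 0" "x = Fract P' Q'" "y' = poly_subst s P' / poly_subst s Q'"
    using assms unfolding specializes_def by blast
  have "Q \<noteq> 0" "Q' \<noteq> 0" using * by auto
  with * have "P * Q' = P' * Q" by (simp add: eq_fract)
  then have "poly_subst s P * poly_subst s Q' = poly_subst s P' * poly_subst s Q"
    by (metis poly_subst_mult)
  then show ?thesis using *(1,3,4,6) by (simp add: frac_eq_eq)
qed

lemma specializes_add:
  assumes "specializes s x y" "specializes s x' y'"
  shows "specializes s (x + x') (y + y')"
proof -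
  obtain P Q P' Q' where *: "poly_subst s Q \<noteq> 0" "x = Fract P Q" "y = poly_subst s P / poly_subst s Q"
     "poly_subst s Q' \<noteq> 0" "x' = Fract P' Q'" "y' = poly_subst s P' / poly_subst s Q'"
    using assms by (auto simp: specializes_def)
  have nz: "Q \<noteq> 0" "Q' \<noteq> 0" using * by auto
  show ?thesis
    unfolding specializes_def
    by (rule exI[of _ "P * Q' + P' * Q"], rule exI[of _ "Q * Q'"])
       (use * nz in \<open>simp add: poly_subst_mult poly_subst_add add_frac_eq\<close>)
qed

lemma specializes_mult:
  assumes "specializes s x y" "specializes s x' y'"
  shows "specializes s (x * x') (y * y')"
proof -
  obtain P Q P' Q' where *: "poly_subst s Q \<noteq> 0" "x = Fract P Q" "y = poly_subst s P / poly_subst s Q"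
     "poly_subst s Q' \<noteq> 0" "x' = Fract P' Q'" "y' = poly_subst s P' / poly_subst s Q'"
    using assms by (auto simp: specializes_def)
  show ?thesis
    unfolding specializes_def
    by (rule exI[of _ "P * P'"], rule exI[of _ "Q * Q'"])
       (use * in \<open>simp add: poly_subst_mult\<close>)
qed

lemma specializes_inverse:
  assumes "specializes s x y" "y \<noteq> 0"
  shows "specializes s (inverse x) (inverse y)"
proof -
  obtain P Q where *: "poly_subst s Q \<noteq> 0" "x = Fract P Q" "y = poly_subst s P / poly_subst s Q"
    using assms by (auto simp: specializes_def)
  show ?thesis
    unfolding specializes_def
    by (rule exI[of _ Q], rule exI[of _ P]) (use * assms(2) in simp)
qed

lemma specializes_divide:
  assumes "specializes s x y" "specializes s x' y'" "y' \<noteq> 0"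
  shows "specializes s (x / x') (y / y')"
  using specializes_mult[OF assms(1) specializes_inverse[OF assms(2,3)]]
  by (simp add: divide_inverse)

lemma specializes_power: "specializes s x y \<Longrightarrow> specializes s (x ^ k) (y ^ k)"
  using specializes_const[of s 1] by (induction k) (auto intro: specializes_mult)

lemma specializes_prod:
  assumes "\<And>i. i \<in> A \<Longrightarrow> specializes s (f i) (g i)"
  shows "specializes s (\<Prod>i\<in>A. f i) (\<Prod>i\<in>A. g i)"
  using assms specializes_const[of s 1]
  by (induction A rule: infinite_finite_induct) (auto intro: specializes_mult)

lemma specializes_sum:
  assumes "\<And>i. i \<in> A \<Longrightarrow> specializes s (f i) (g i)"
  shows "specializes s (\<Sum>i\<in>A. f i) (\<Sum>i\<in>A. g i)"
  using assms specializes_const[of s 0]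
  by (induction A rule: infinite_finite_induct) (auto intro: specializes_add)

lemma specializes_poly_subst:
  assumes "\<And>l. specializes s (r l) (q l)"
  shows "specializes s (poly_subst r P) (poly_subst q P)"
  unfolding poly_subst_def monomial_subst_def
  by (intro specializes_sum specializes_mult specializes_const specializes_prod specializes_power assms)

text \<open>
  Applying \<open>s'\<close> after \<open>s\<close> returns every polynomial to itself, because it does so on the variables.
  Hence a polynomial that \<open>s\<close> kills is the image of \<open>0\<close>. This is how injectivity, and with it the
  extension to the whole field, follows from the group law alone, without any argument about
  algebraic independence.
\<close>

lemma poly_subst_inj_if_left_inverse:
  assumes "\<And>l. specializes s' (s l) (ratvar l)" "poly_subst s P = 0"
  shows "P = 0"
proof -
  have "specializes s' 0 (Fract P 1)"
    using specializes_poly_subst[of s' s ratvar P] assms by (simp add: poly_subst_ratvar)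
  moreover have "specializes s' 0 0"
    using specializes_const[of s' 0] by simp
  ultimately have "Fract P 1 = 0" by (rule specializes_unique)
  then show ?thesis by (simp add: Zero_fract_def eq_fract)
qed

lemma specializes_by_ratvar: "specializes ratvar x x"
proof -
  obtain P Q where "x = Fract P Q" "Q \<noteq> 0" by (cases x) auto
  then show ?thesis
    using specializes_Fract[of ratvar Q P]
    by (auto simp: poly_subst_ratvar Zero_fract_def eq_fract)
qed

definition ratfun_subst :: "(nat \<Rightarrow> cratfun) \<Rightarrow> cratfun \<Rightarrow> cratfun" where
  "ratfun_subst s x = (THE y. specializes s x y)"

lemma ratfun_subst_eqI: "specializes s x y \<Longrightarrow> ratfun_subst s x = y"
  unfolding ratfun_subst_def by (blast intro: the_equality specializes_unique)

lemma ratfuns_add: "x \<in> ratfuns m \<Longrightarrow> y \<in> ratfuns m \<Longrightarrow> x + y \<in> ratfuns m"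
  using subringE(7)[OF subfieldE(1)[OF ratfuns_subfield]]
  by (simp add: ring_of_type_algebra_def)

lemma ratfuns_mult: "x \<in> ratfuns m \<Longrightarrow> y \<in> ratfuns m \<Longrightarrow> x * y \<in> ratfuns m"
  using subringE(6)[OF subfieldE(1)[OF ratfuns_subfield]]
  by (simp add: ring_of_type_algebra_def)

lemma ratfuns_divide:
  assumes "x \<in> ratfuns m" "y \<in> ratfuns m"
  shows "x / y \<in> ratfuns m"
proof (cases "y = 0")
  case True
  then show ?thesis using const_ratfun_in_ratfuns[of 0 m] by simp
next
  case False
  obtain P Q where y: "y = Fract P Q" "vars P \<subseteq> {..<m}" "vars Q \<subseteq> {..<m}"
    using assms(2) by (auto simp: ratfuns_def)
  moreover from this False have "P \<noteq> 0" by (auto simp: fract_collapse)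
  ultimately have "inverse y \<in> ratfuns m"
    by (auto simp: ratfuns_def)
  then show ?thesis
    using ratfuns_mult[OF assms(1)] by (simp add: divide_inverse)
qed

lemma ratfuns_prod: "(\<And>i. i \<in> A \<Longrightarrow> f i \<in> ratfuns m) \<Longrightarrow> (\<Prod>i\<in>A. f i) \<in> ratfuns m"
  using const_ratfun_in_ratfuns[of 1 m]
  by (induction A rule: infinite_finite_induct) (auto intro: ratfuns_mult)

lemma ratfuns_sum: "(\<And>i. i \<in> A \<Longrightarrow> f i \<in> ratfuns m) \<Longrightarrow> (\<Sum>i\<in>A. f i) \<in> ratfuns m"
  using const_ratfun_in_ratfuns[of 0 m]
  by (induction A rule: infinite_finite_induct) (auto intro: ratfuns_add)

lemma ratfuns_power: "x \<in> ratfuns m \<Longrightarrow> x ^ k \<in> ratfuns m"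
  using const_ratfun_in_ratfuns[of 1 m]
  by (induction k) (auto intro: ratfuns_mult)

lemma ratvar_in_ratfuns:
  assumes "l < m"
  shows "ratvar l \<in> ratfuns m"
proof -
  have "vars (Poly_Mapping.single (Poly_Mapping.single l 1) 1) \<subseteq> {..<m}" "vars 1 \<subseteq> {..<m}"
    using assms by (simp_all add: vars_def)
  then show ?thesis
    unfolding ratvar_def ratfuns_def using one_neq_zero[where 'a = cpoly] by blast
qed

lemma poly_subst_in_ratfuns:
  assumes "\<And>l. l < m \<Longrightarrow> s l \<in> ratfuns m" "vars P \<subseteq> {..<m}"
  shows "poly_subst s P \<in> ratfuns m"
proof -
  have "s l \<in> ratfuns m" if "u \<in> Poly_Mapping.keys P" "l \<in> Poly_Mapping.keys u" for u l
    using assms that by (auto simp: vars_def)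
  then show ?thesis
    unfolding poly_subst_def monomial_subst_def
    by (intro ratfuns_sum ratfuns_mult ratfuns_prod ratfuns_power const_ratfun_in_ratfuns)
qed

text \<open>
  Since \<open>s (inv g)\<close> undoes \<open>s g\<close>, each \<open>s g\<close> is injective on polynomials and extends to an
  endomorphism of the field of fractions. These endomorphisms compose like elements of \<open>G\<close>,
  because they do so on the variables; they are therefore bijective, and they preserve the
  subfield in the first \<open>m\<close> variables by \<open>closed\<close>.
\<close>

lemma crd_le_of_substitution_action:
  fixes G (structure) and s :: "'a \<Rightarrow> nat \<Rightarrow> cratfun"
  assumes "group G"
    and one: "\<And>l. s \<one> l = ratvar l"
    and comp: "\<And>g h l. g \<in> carrier G \<Longrightarrow> h \<in> carrier G \<Longrightarrow>
                 specializes (s g) (s h l) (s (g \<otimes> h) l)"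
    and closed: "\<And>g l. g \<in> carrier G \<Longrightarrow> l < m \<Longrightarrow> s g l \<in> ratfuns m"
    and faithful: "\<And>g. g \<in> carrier G \<Longrightarrow> (\<And>l. l < m \<Longrightarrow> s g l = ratvar l) \<Longrightarrow> g = \<one>"
  shows "crd G \<le> enat m"
proof -
  interpret G: group G by fact
  let ?F = "ratfuns m" and ?L = "ratfun_field m"
  define \<sigma> where "\<sigma> g = ratfun_subst (s g)" for g
  have inj: "P = 0" if "g \<in> carrier G" "poly_subst (s g) P = 0" for g P
  proof (rule poly_subst_inj_if_left_inverse[OF _ that(2)])
    show "specializes (s (inv g)) (s g l) (ratvar l)" for l
      using comp[of "inv g" g l] that(1) by (simp add: one)
  qed
  have graph: "specializes (s g) x (\<sigma> g x)" if "g \<in> carrier G" for g x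
  proof -
    obtain P Q where x: "x = Fract P Q" "Q \<noteq> 0" by (cases x) auto
    then have "specializes (s g) x (poly_subst (s g) P / poly_subst (s g) Q)"
      using specializes_Fract inj[OF that] by blast
    then show ?thesis unfolding \<sigma>_def using ratfun_subst_eqI by metis
  qed
  have eqI: "\<sigma> g x = y" if "specializes (s g) x y" for g x y
    using ratfun_subst_eqI[OF that] by (simp add: \<sigma>_def)
  have add: "\<sigma> g (x + y) = \<sigma> g x + \<sigma> g y"
    and mult: "\<sigma> g (x * y) = \<sigma> g x * \<sigma> g y" if "g \<in> carrier G" for g x y
    using graph[OF that] by (blast intro: eqI specializes_add specializes_mult)+
  have const: "\<sigma> g (const_ratfun c) = const_ratfun c" for g c
    by (rule eqI[OF specializes_const])
  have var: "\<sigma> g (ratvar l) = s g l" for g l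
    by (rule eqI[OF specializes_ratvar])
  have id: "\<sigma> \<one> x = x" for x
  proof (rule eqI)
    have "s \<one> = ratvar" using one by auto
    then show "specializes (s \<one>) x x" by (simp add: specializes_by_ratvar)
  qed
  have act: "\<sigma> g (\<sigma> h x) = \<sigma> (g \<otimes> h) x" if g: "g \<in> carrier G" and h: "h \<in> carrier G" for g h x
  proof -
    obtain P Q where x: "x = Fract P Q" "Q \<noteq> 0" by (cases x) auto
    have nz: "poly_subst (s h) Q \<noteq> 0" "poly_subst (s (g \<otimes> h)) Q \<noteq> 0"
      using inj x(2) g h by blast+
    have "specializes (s g) (poly_subst (s h) P / poly_subst (s h) Q)
        (poly_subst (s (g \<otimes> h)) P / poly_subst (s (g \<otimes> h)) Q)"
      using comp[OF g h] nz by (intro specializes_divide specializes_poly_subst) auto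
    moreover have "\<sigma> h x = poly_subst (s h) P / poly_subst (s h) Q"
      "\<sigma> (g \<otimes> h) x = poly_subst (s (g \<otimes> h)) P / poly_subst (s (g \<otimes> h)) Q"
      using nz unfolding x by (auto intro: eqI specializes_Fract)
    ultimately show ?thesis by (simp add: eqI)
  qed
  have stable: "\<sigma> g x \<in> ?F" if g: "g \<in> carrier G" and F: "x \<in> ?F" for g x
  proof -
    obtain P Q where x: "x = Fract P Q" "Q \<noteq> 0" "vars P \<subseteq> {..<m}" "vars Q \<subseteq> {..<m}"
      using F unfolding ratfuns_def by blast
    then have "\<sigma> g x = poly_subst (s g) P / poly_subst (s g) Q"
      using inj[OF g, of Q] by (auto intro!: eqI specializes_Fract)
    then show ?thesis
      using x closed[OF g] by (simp add: ratfuns_divide poly_subst_in_ratfuns)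
  qed
  have car [simp]: "carrier ?L = ?F"
    and ops [simp]: "x \<otimes>\<^bsub>?L\<^esub> y = x * y" "x \<oplus>\<^bsub>?L\<^esub> y = x + y" "\<one>\<^bsub>?L\<^esub> = 1" for x y
    by (simp_all add: ratfun_field_def ring_of_type_algebra_def)
  define \<phi> where "\<phi> g = restrict (\<sigma> g) ?F" for g
  have aut: "\<phi> g \<in> aut_over ?L (range const_ratfun)" if g: "g \<in> carrier G" for g
  proof -
    have "bij_betw (\<sigma> g) ?F ?F"
      by (rule bij_betw_byWitness[where f' = "\<sigma> (inv g)"])
         (use g stable in \<open>auto simp: act id\<close>)
    then have "bij_betw (\<phi> g) ?F ?F"
      by (simp add: \<phi>_def cong: bij_betw_cong)
    moreover have "\<phi> g \<in> ring_hom ?L ?L"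
    proof (rule ring_hom_memI)
      have "1 \<in> ?F" using const_ratfun_in_ratfuns[of 1 m] by simp
      then show "\<phi> g \<one>\<^bsub>?L\<^esub> = \<one>\<^bsub>?L\<^esub>"
        using const[of g 1] by (simp add: \<phi>_def)
    qed (use g stable in \<open>auto simp: \<phi>_def add mult ratfuns_add ratfuns_mult\<close>)
    ultimately show ?thesis
      by (auto simp: aut_over_def ring_iso_def \<phi>_def const const_ratfun_in_ratfuns)
  qed
  interpret C: group "Cremona m" by (rule Cremona_group)
  have carC: "carrier (Cremona m) = aut_over ?L (range const_ratfun)"
    by (simp add: Cremona_def AutGroup_over_def)
  have multC: "f \<otimes>\<^bsub>Cremona m\<^esub> h = compose ?F f h" if "f \<in> carrier (Cremona m)" "h \<in> carrier (Cremona m)" for f h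
  proof -
    have "f \<in> Bij ?F" "h \<in> Bij ?F"
      using that by (auto simp: carC aut_over_def Bij_def ring_iso_def)
    then show ?thesis
      by (simp add: Cremona_def AutGroup_over_def BijGroup_def)
  qed
  have hom: "\<phi> \<in> hom G (Cremona m)"
  proof (rule homI)
    fix g h assume gh: "g \<in> carrier G" "h \<in> carrier G"
    have "\<phi> g \<otimes>\<^bsub>Cremona m\<^esub> \<phi> h = compose ?F (\<phi> g) (\<phi> h)"
      by (rule multC) (use gh aut carC in auto)
    also have "\<dots> = \<phi> (g \<otimes> h)"
      using gh stable by (auto simp: compose_def \<phi>_def act fun_eq_iff)
    finally show "\<phi> (g \<otimes> h) = \<phi> g \<otimes>\<^bsub>Cremona m\<^esub> \<phi> h" by simp
  qed (simp add: carC aut)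
  interpret \<phi>: group_hom G "Cremona m" \<phi>
    by unfold_locales (rule hom)
  have "inj_on \<phi> (carrier G)"
    unfolding \<phi>.inj_on_one_iff
  proof (intro allI impI)
    fix g assume g: "g \<in> carrier G" and eq: "\<phi> g = \<one>\<^bsub>Cremona m\<^esub>"
    then have "\<phi> g = \<phi> \<one>" by simp
    then have "\<sigma> g x = x" if "x \<in> ?F" for x
      using that id unfolding \<phi>_def by (metis restrict_apply')
    then have "s g l = ratvar l" if "l < m" for l
      using that ratvar_in_ratfuns var by metis
    then show "g = \<one>" by (rule faithful[OF g])
  qed
  then have "\<phi> \<in> iso G ((Cremona m)\<lparr>carrier := \<phi> ` carrier G\<rparr>)"
    using hom by (auto simp: iso_def hom_def bij_betw_def)
  then have "G \<cong> (Cremona m)\<lparr>carrier := \<phi> ` carrier G\<rparr>"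
    by (auto simp: is_iso_def)
  with \<phi>.img_is_subgroup show ?thesis
    unfolding crd_def by (intro Inf_lower) blast
qed

section \<open>Splitting the cocycle of an extraspecial group\<close>

definition (in group) comm :: "'a \<Rightarrow> 'a \<Rightarrow> 'a" where
  "comm g h = g \<otimes> h \<otimes> inv g \<otimes> inv h"

text \<open>
  The induction below passes to subgroups that contain \<open>Z\<close>, so only properties that such subgroups
  inherit are recorded: \<open>Z\<close> is central of order \<open>p\<close> and contains all commutators and all \<open>p\<close>-th
  powers. That \<open>Z\<close> is the full centre is kept as a separate hypothesis where it is needed. The
  faithful character \<open>lam\<close> of \<open>Z\<close> is fixed once and for all so that the data of different
  subgroups fit together.
\<close>

locale heisenberg_type = group +
  fixes p :: nat and Z :: "'a set" and lam :: "'a \<Rightarrow> complex"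
  assumes prime_p: "Factorial_Ring.prime p"
    and Z_subgroup: "subgroup Z G"
    and Z_central: "z \<in> Z \<Longrightarrow> g \<in> carrier G \<Longrightarrow> z \<otimes> g = g \<otimes> z"
    and card_Z: "card Z = p"
    and comm_in_Z: "g \<in> carrier G \<Longrightarrow> h \<in> carrier G \<Longrightarrow> comm g h \<in> Z"
    and pow_in_Z: "g \<in> carrier G \<Longrightarrow> g [^] p \<in> Z"
    and lam_mult: "z \<in> Z \<Longrightarrow> w \<in> Z \<Longrightarrow> lam (z \<otimes> w) = lam z * lam w"
    and lam_one: "lam \<one> = 1"
    and lam_faithful: "z \<in> Z \<Longrightarrow> lam z = 1 \<Longrightarrow> z = \<one>"

context group
begin

lemma comm_closed [simp]: "g \<in> carrier G \<Longrightarrow> h \<in> carrier G \<Longrightarrow> comm g h \<in> carrier G"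
  by (simp add: comm_def)

lemma comm_swap:
  assumes [simp]: "g \<in> carrier G" "h \<in> carrier G"
  shows "g \<otimes> h = comm g h \<otimes> (h \<otimes> g)"
proof -
  have "inv h \<otimes> (h \<otimes> g) = g" by (simp flip: m_assoc)
  then show ?thesis by (simp add: comm_def m_assoc)
qed

lemma comm_eqI:
  "g \<otimes> h = z \<otimes> (h \<otimes> g) \<Longrightarrow> g \<in> carrier G \<Longrightarrow> h \<in> carrier G \<Longrightarrow> z \<in> carrier G \<Longrightarrow> comm g h = z"
  by (metis comm_closed comm_swap m_closed r_cancel)

lemma comm_eq_one_iff:
  "g \<in> carrier G \<Longrightarrow> h \<in> carrier G \<Longrightarrow> comm g h = \<one> \<longleftrightarrow> g \<otimes> h = h \<otimes> g"
  by (metis comm_eqI comm_swap l_one m_closed one_closed)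

text \<open>
  A nontrivial element of a group of prime order generates it, by Lagrange's theorem.
\<close>

lemma discrete_log:
  assumes "subgroup Z G" "card Z = p" "Factorial_Ring.prime p" "z \<in> Z" "z \<noteq> \<one>"
  shows "bij_betw (\<lambda>k::nat. z [^] k) {..<p} Z" and "z [^] p = \<one>"
proof -
  interpret Z: group "G\<lparr>carrier := Z\<rparr>"
    by (rule subgroup.subgroup_is_group[OF assms(1)]) (rule group_axioms)
  have z: "z \<in> carrier G" using assms(1,4) by (rule subgroup.mem_carrier)
  show pow: "z [^] p = \<one>"
    using Z.pow_order_eq_1[of z] assms(2,4) by (simp add: Coset.order_def flip: nat_pow_consistent)
  have "p > 0" using assms(3) by (simp add: prime_gt_0_nat)
  have "group.ord G z dvd p" using pow z pow_eq_id by blast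
  then have ord: "ord z = p"
    using assms(3,5) z ord_eq_1 by (metis prime_nat_iff)
  have "inj_on (\<lambda>k::nat. z [^] k) {..<p}"
    by (rule inj_on_subset[OF ord_inj[OF z]]) (use \<open>p > 0\<close> ord in auto)
  moreover have "(\<lambda>k::nat. z [^] k) ` {..<p} \<subseteq> Z"
    using Z.nat_pow_closed[of z] assms(4) by (auto simp flip: nat_pow_consistent)
  moreover have "finite Z" using assms(2) \<open>p > 0\<close> card_gt_0_iff by blast
  ultimately show "bij_betw (\<lambda>k::nat. z [^] k) {..<p} Z"
    using assms(2) by (simp add: bij_betw_def card_image card_subset_eq)
qed

text \<open>
  Send a generator to a primitive \<open>p\<close>-th root of unity.
\<close>

lemma faithful_character_exists:
  assumes "subgroup Z G" "card Z = p" "Factorial_Ring.prime p"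
  shows "\<exists>lam :: 'a \<Rightarrow> complex. (\<forall>z\<in>Z. \<forall>w\<in>Z. lam (z \<otimes> w) = lam z * lam w) \<and> lam \<one> = 1 \<and>
           (\<forall>z\<in>Z. lam z = 1 \<longrightarrow> z = \<one>)"
proof -
  have "p > 1" using assms(3) by (rule prime_gt_1_nat)
  then have "\<exists>z\<in>Z. z \<noteq> \<one>"
    using assms(1,2) by (metis One_nat_def card_le_Suc0_iff_eq card.infinite less_nat_zero_code
       not_less subgroup.one_closed)
  then obtain z where z: "z \<in> Z" "z \<noteq> \<one>" by blast
  note log = discrete_log[OF assms z]
  have zG: "z \<in> carrier G" using assms(1) z(1) by (rule subgroup.mem_carrier)
  define d where "d = inv_into {..<p} (\<lambda>k::nat. z [^] k)"
  have d: "z [^] d w = w" "d w < p" if "w \<in> Z" for w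
    using that log(1) unfolding d_def bij_betw_def
    by (metis f_inv_into_f, metis inv_into_into lessThan_iff)
  define \<zeta> where "\<zeta> = cis (2 * pi / p)"
  have pow\<zeta>: "\<zeta> ^ k = cis (2 * pi * k / p)" for k
    by (simp add: \<zeta>_def Complex.DeMoivre field_simps)
  have "\<zeta> ^ p = 1" using \<open>p > 1\<close> by (simp add: pow\<zeta>)
  then have mod: "\<zeta> ^ k = \<zeta> ^ (k mod p)" for k
    by (metis mod_mult_div_eq power_add power_mult power_one mult.right_neutral)
  have modz: "z [^] k = z [^] (k mod p)" for k
    using log(2) zG by (metis mod_mult_div_eq mult.commute nat_pow_mult nat_pow_one nat_pow_pow
      nat_pow_closed r_one)
  have faithful: "k = 0" if "\<zeta> ^ k = 1" "k < p" for k
  proof -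
    have "cos (2 * pi * k / p) = 1" using that(1) pow\<zeta>[of k] by (simp add: complex_eq_iff)
    then obtain n :: int where "2 * pi * k / p = n * (2 * pi)" by (auto simp: cos_one_2pi_int)
    then have "real k = of_int (n * int p)" using \<open>p > 1\<close> by (simp add: field_simps)
    then have "int k = n * int p" by linarith
    then have "int p dvd int k" by simp
    then have "p dvd k" by simp
    then show "k = 0" using that(2) by (auto dest: dvd_imp_le)
  qed
  show ?thesis
  proof (intro exI[of _ "\<lambda>w. \<zeta> ^ d w"] conjI ballI impI)
    fix v w assume vw: "v \<in> Z" "w \<in> Z"
    then have vwZ: "v \<otimes> w \<in> Z" using assms(1) subgroup.m_closed by metis
    have "z [^] ((d v + d w) mod p) = v \<otimes> w"
      using d(1)[OF vw(1)] d(1)[OF vw(2)] zG by (metis modz nat_pow_mult)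
    then have "z [^] ((d v + d w) mod p) = z [^] d (v \<otimes> w)" using d(1)[OF vwZ] by simp
    then have "(d v + d w) mod p = d (v \<otimes> w)"
      using log(1) d(2)[OF vwZ] \<open>p > 1\<close>
      by (auto simp: bij_betw_def inj_on_def)
    then show "\<zeta> ^ d (v \<otimes> w) = \<zeta> ^ d v * \<zeta> ^ d w"
      by (metis mod power_add)
  next
    have o: "\<one> \<in> Z" using assms(1) by (rule subgroup.one_closed)
    have "z [^] d \<one> = z [^] (0::nat)" using d(1)[OF o] by simp
    then have "d \<one> = 0" using log(1) d(2)[OF o] \<open>p > 1\<close>
      by (auto simp: bij_betw_def inj_on_def simp del: nat_pow_0)
    then show "\<zeta> ^ d \<one> = 1" by simp
  next
    fix w assume "w \<in> Z" "\<zeta> ^ d w = 1"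
    then have "d w = 0" using d(2) faithful by blast
    then show "w = \<one>" using d(1)[OF \<open>w \<in> Z\<close>] by simp
  qed
qed

end

context heisenberg_type
begin

text \<open>
  Such a \<open>\<theta>\<close> expresses that the class of the central extension of \<open>H / Z\<close> by \<open>Z\<close>, pushed forward
  along \<open>lam\<close>, is up to sign the sum of the cup products of the characters \<open>\<gamma> i\<close> with the
  homomorphisms \<open>b i\<close>. The values of \<open>b i\<close> are
  natural numbers that represent residues modulo \<open>p\<close>; they serve as exponents of \<open>p\<close>-th roots of
  unity and as cyclic shifts of indices, so only the residue matters.
\<close>

definition splits_cocycle :: "nat \<Rightarrow> 'a set \<Rightarrow> ('a \<Rightarrow> complex) \<Rightarrow> (nat \<Rightarrow> 'a \<Rightarrow> complex) \<Rightarrow>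
    (nat \<Rightarrow> 'a \<Rightarrow> nat) \<Rightarrow> bool" where
  "splits_cocycle n H \<theta> \<gamma> b \<longleftrightarrow>
     (\<forall>g\<in>H. \<forall>h\<in>H. \<theta> (g \<otimes> h) = \<theta> g * \<theta> h * (\<Prod>i<n. \<gamma> i g ^ b i h)) \<and>
     (\<forall>i<n. \<forall>g\<in>H. \<forall>h\<in>H. \<gamma> i (g \<otimes> h) = \<gamma> i g * \<gamma> i h) \<and>
     (\<forall>i<n. \<forall>g\<in>H. \<gamma> i g ^ p = 1) \<and>
     (\<forall>i<n. \<forall>g\<in>H. \<forall>h\<in>H. b i (g \<otimes> h) mod p = (b i g + b i h) mod p) \<and>
     (\<forall>z\<in>Z. \<theta> z = lam z \<and> (\<forall>i<n. \<gamma> i z = 1 \<and> b i z = 0))"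

lemma Z_carrier [simp]: "z \<in> Z \<Longrightarrow> z \<in> carrier G"
  using subgroup.mem_carrier[OF Z_subgroup] .

lemma Z_mult [simp]: "z \<in> Z \<Longrightarrow> w \<in> Z \<Longrightarrow> z \<otimes> w \<in> Z"
  using subgroup.m_closed[OF Z_subgroup] .

lemma Z_one [simp]: "\<one> \<in> Z"
  using subgroup.one_closed[OF Z_subgroup] .

lemma Z_pow [simp]: "z \<in> Z \<Longrightarrow> z [^] (k::nat) \<in> Z"
  by (induction k) auto

lemma Z_left_commute:
  "z \<in> Z \<Longrightarrow> g \<in> carrier G \<Longrightarrow> h \<in> carrier G \<Longrightarrow> g \<otimes> (z \<otimes> h) = z \<otimes> (g \<otimes> h)"
  using Z_central by (metis Z_carrier m_assoc)

lemma p_gt_0: "p > 0"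
  using prime_p by (simp add: prime_gt_0_nat)

lemma Z_pow_p: "z \<in> Z \<Longrightarrow> z [^] p = \<one>"
  using discrete_log(2)[OF Z_subgroup card_Z prime_p] by (cases "z = \<one>") auto

lemma lam_pow: "z \<in> Z \<Longrightarrow> lam (z [^] (k::nat)) = lam z ^ k"
  by (induction k) (simp_all add: lam_mult lam_one)

lemma lam_pow_p: "z \<in> Z \<Longrightarrow> lam z ^ p = 1"
  by (metis Z_pow_p lam_one lam_pow)

lemma comm_mult_left:
  assumes [simp]: "g \<in> carrier G" "g' \<in> carrier G" "h \<in> carrier G"
  shows "comm (g \<otimes> g') h = comm g h \<otimes> comm g' h"
proof (rule comm_eqI)
  have "g \<otimes> g' \<otimes> h = g \<otimes> (comm g' h \<otimes> (h \<otimes> g'))"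
    using comm_swap[of g' h] by (simp add: m_assoc)
  also have "\<dots> = comm g' h \<otimes> (g \<otimes> h \<otimes> g')"
    using Z_left_commute[of "comm g' h" g "h \<otimes> g'"] by (simp add: comm_in_Z m_assoc)
  also have "\<dots> = comm g' h \<otimes> (comm g h \<otimes> (h \<otimes> (g \<otimes> g')))"
    using comm_swap[of g h] by (simp add: m_assoc)
  also have "\<dots> = comm g h \<otimes> comm g' h \<otimes> (h \<otimes> (g \<otimes> g'))"
    by (simp add: Z_central[of "comm g' h" "comm g h"] comm_in_Z flip: m_assoc)
  finally show "g \<otimes> g' \<otimes> h = comm g h \<otimes> comm g' h \<otimes> (h \<otimes> (g \<otimes> g'))" .
qed auto

lemma comm_mult_right:
  assumes [simp]: "g \<in> carrier G" "h \<in> carrier G" "h' \<in> carrier G"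
  shows "comm g (h \<otimes> h') = comm g h \<otimes> comm g h'"
proof (rule comm_eqI)
  have "g \<otimes> (h \<otimes> h') = comm g h \<otimes> (h \<otimes> (g \<otimes> h'))"
    using comm_swap[of g h] by (simp flip: m_assoc)
  also have "\<dots> = comm g h \<otimes> (h \<otimes> (comm g h' \<otimes> (h' \<otimes> g)))"
    using comm_swap[of g h'] by simp
  also have "\<dots> = comm g h \<otimes> comm g h' \<otimes> (h \<otimes> h' \<otimes> g)"
    using Z_left_commute[of "comm g h'" h "h' \<otimes> g"] by (simp add: comm_in_Z m_assoc)
  finally show "g \<otimes> (h \<otimes> h') = comm g h \<otimes> comm g h' \<otimes> (h \<otimes> h' \<otimes> g)" .
qed auto

lemma comm_self [simp]: "g \<in> carrier G \<Longrightarrow> comm g g = \<one>"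
  by (simp add: comm_eq_one_iff)

lemma comm_Z_left [simp]: "z \<in> Z \<Longrightarrow> g \<in> carrier G \<Longrightarrow> comm z g = \<one>"
  by (simp add: comm_eq_one_iff Z_central)

lemma comm_Z_right [simp]: "z \<in> Z \<Longrightarrow> g \<in> carrier G \<Longrightarrow> comm g z = \<one>"
  by (simp add: comm_eq_one_iff Z_central)

lemma comm_pow_left:
  "g \<in> carrier G \<Longrightarrow> h \<in> carrier G \<Longrightarrow> comm (g [^] (k::nat)) h = comm g h [^] k"
  by (induction k) (simp_all add: comm_mult_left)

lemma comm_pow_right:
  "g \<in> carrier G \<Longrightarrow> h \<in> carrier G \<Longrightarrow> comm g (h [^] (k::nat)) = comm g h [^] k"
  by (induction k) (simp_all add: comm_mult_right)

end

text \<open>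
  The commutator is a bilinear alternating form on \<open>H / Z\<close> with values in \<open>Z\<close>. Two elements that
  do not commute span a hyperbolic plane, and \<open>H\<close> is the central product of the subgroup that they
  generate with the orthogonal complement \<open>C\<close> of the plane. Accordingly every element \<open>g\<close> of \<open>H\<close>
  has a normal form \<open>x\<^sup>i y\<^sup>j c\<close> with \<open>i, j < p\<close> and \<open>c \<in> C\<close>.
\<close>

locale hyperbolic_pair = heisenberg_type +
  fixes H x y
  assumes H_subgroup: "subgroup H G" and Z_le_H: "Z \<subseteq> H"
    and xH: "x \<in> H" and yH: "y \<in> H" and not_commuting: "comm x y \<noteq> \<one>"
begin

definition C where "C = {c \<in> H. comm c y = \<one> \<and> comm x c = \<one>}"

definition log :: "'a \<Rightarrow> nat" where "log = inv_into {..<p} (\<lambda>k. comm x y [^] k)"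

text \<open>
  The coordinates along the plane are read off from the form: as \<open>comm x x\<close> and \<open>comm y y\<close> are
  trivial, pairing with \<open>y\<close> sees only the exponent of \<open>x\<close>, and pairing with \<open>x\<close> only that of
  \<open>y\<close>.
\<close>

definition xcoord :: "'a \<Rightarrow> nat" where "xcoord g = log (comm g y)"

definition ycoord :: "'a \<Rightarrow> nat" where "ycoord g = log (comm x g)"

definition plane_part where "plane_part g = x [^] xcoord g \<otimes> y [^] ycoord g"

definition C_part where "C_part g = inv (plane_part g) \<otimes> g"

lemma H_carrier [simp]: "g \<in> H \<Longrightarrow> g \<in> carrier G"
  using subgroup.mem_carrier[OF H_subgroup] .

lemma H_mult [simp]: "g \<in> H \<Longrightarrow> h \<in> H \<Longrightarrow> g \<otimes> h \<in> H"
  using subgroup.m_closed[OF H_subgroup] .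

lemma H_inv [simp]: "g \<in> H \<Longrightarrow> inv g \<in> H"
  using subgroup.m_inv_closed[OF H_subgroup] .

lemma H_one [simp]: "\<one> \<in> H"
  using subgroup.one_closed[OF H_subgroup] .

lemma H_pow [simp]: "g \<in> H \<Longrightarrow> g [^] (k::nat) \<in> H"
  by (induction k) auto

lemma xy_simps [simp]: "x \<in> H" "y \<in> H" "x \<in> carrier G" "y \<in> carrier G" "comm x y \<in> Z"
  using xH yH by (auto simp: comm_in_Z)

lemma log_bij: "bij_betw (\<lambda>k::nat. comm x y [^] k) {..<p} Z"
  using discrete_log(1)[OF Z_subgroup card_Z prime_p _ not_commuting] by simp

lemma comm_pow_log: "z \<in> Z \<Longrightarrow> comm x y [^] log z = z"
  using log_bij unfolding log_def bij_betw_def by (metis f_inv_into_f)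

lemma log_less: "z \<in> Z \<Longrightarrow> log z < p"
  using log_bij unfolding log_def bij_betw_def by (metis inv_into_into lessThan_iff)

lemma log_pow: "log (comm x y [^] k) = k mod p"
proof -
  have "comm x y [^] k = comm x y [^] (p * (k div p)) \<otimes> comm x y [^] (k mod p)"
    by (simp add: nat_pow_mult)
  also have "comm x y [^] (p * (k div p)) = \<one>"
    by (simp add: Z_pow_p flip: nat_pow_pow)
  finally have "comm x y [^] k = comm x y [^] (k mod p)" by simp
  moreover have "log (comm x y [^] (k mod p)) = k mod p"
    using log_bij p_gt_0 unfolding log_def bij_betw_def by (simp add: inv_into_f_f)
  ultimately show ?thesis by simp
qed

lemma log_mult: "z \<in> Z \<Longrightarrow> w \<in> Z \<Longrightarrow> log (z \<otimes> w) = (log z + log w) mod p"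
  by (metis comm_pow_log log_pow nat_pow_mult xy_simps(5) Z_carrier)

lemma coords_mult:
  assumes "g \<in> H" "h \<in> H"
  shows "xcoord (g \<otimes> h) = (xcoord g + xcoord h) mod p"
    and "ycoord (g \<otimes> h) = (ycoord g + ycoord h) mod p"
  using assms by (simp_all add: xcoord_def ycoord_def comm_mult_left comm_mult_right log_mult comm_in_Z)

lemma coords_Z: "z \<in> Z \<Longrightarrow> xcoord z = 0 \<and> ycoord z = 0"
  using log_pow[of 0] p_gt_0 by (simp add: xcoord_def ycoord_def)

lemma C_in_H: "c \<in> C \<Longrightarrow> c \<in> H"
  by (simp add: C_def)

lemma C_subgroup: "subgroup C G"
proof (rule subgroupI)
  fix c assume c: "c \<in> C"
  then have [simp]: "c \<in> H" and eq: "comm c y = \<one>" "comm x c = \<one>" by (simp_all add: C_def)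
  have "comm (inv c) y \<otimes> comm c y = \<one>" "comm x (inv c) \<otimes> comm x c = \<one>"
    by (simp_all flip: comm_mult_left comm_mult_right)
  then show "inv c \<in> C" by (simp add: C_def eq)
next
  have "\<one> \<in> C" by (simp add: C_def)
  then show "C \<noteq> {}" by blast
qed (auto simp: C_def comm_mult_left comm_mult_right)

lemma Z_le_C: "Z \<subseteq> C"
  using Z_le_H by (auto simp: C_def)

lemma plane_part_H [simp]: "plane_part g \<in> H"
  by (simp add: plane_part_def)

lemma decompose: "g \<in> H \<Longrightarrow> plane_part g \<otimes> C_part g = g"
  by (simp add: C_part_def flip: m_assoc)

lemma C_part_C [simp]:
  assumes "g \<in> H"
  shows "C_part g \<in> C"
proof -
  have c [simp]: "C_part g \<in> H" using assms by (simp add: C_part_def)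
  have pl: "comm (plane_part g) y = comm g y" "comm x (plane_part g) = comm x g"
    using assms
    by (simp_all add: plane_part_def comm_mult_left comm_mult_right comm_pow_left comm_pow_right
         xcoord_def ycoord_def comm_pow_log comm_in_Z)
  have "comm g y = comm (plane_part g) y \<otimes> comm (C_part g) y"
    using decompose[OF assms] by (simp flip: comm_mult_left)
  moreover have "comm x g = comm x (plane_part g) \<otimes> comm x (C_part g)"
    using decompose[OF assms] by (simp flip: comm_mult_right)
  ultimately show ?thesis
    using assms unfolding C_def pl by simp
qed

lemma C_commutes:
  assumes "c \<in> C"
  shows "c \<otimes> x [^] (k::nat) = x [^] k \<otimes> c" "c \<otimes> y [^] (k::nat) = y [^] k \<otimes> c"
    "c \<otimes> plane_part g = plane_part g \<otimes> c"
proof -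
  have c: "comm c y = \<one>" "comm x c = \<one>" and [simp]: "c \<in> carrier G"
    using assms by (auto simp: C_def)
  have "comm (x [^] k) c = \<one>" for k :: nat by (simp add: comm_pow_left c)
  then show x: "c \<otimes> x [^] k = x [^] k \<otimes> c" for k :: nat
    by (simp add: comm_eq_one_iff)
  have "comm c (y [^] k) = \<one>" for k :: nat by (simp add: comm_pow_right c)
  then show y: "c \<otimes> y [^] k = y [^] k \<otimes> c" for k :: nat
    by (simp add: comm_eq_one_iff)
  show "c \<otimes> plane_part g = plane_part g \<otimes> c"
    unfolding plane_part_def by (simp add: x flip: m_assoc) (simp add: y m_assoc)
qed

text \<open>
  The normal form is unique, since the coordinates recover the two exponents.
\<close>

lemma card_H: "card H = p * p * card C"
proof -
  define f where "f = (\<lambda>((i::nat, j::nat), c). x [^] i \<otimes> y [^] j \<otimes> c)"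
  let ?D = "({..<p} \<times> {..<p}) \<times> C"
  have "inj_on f ?D"
  proof (rule inj_onI)
    have coords: "xcoord (x [^] i \<otimes> y [^] j \<otimes> c) = i" "ycoord (x [^] i \<otimes> y [^] j \<otimes> c) = j"
      if "i < p" "j < p" "c \<in> C" for i j :: nat and c
      using that C_in_H[OF that(3)]
      by (simp_all add: xcoord_def ycoord_def comm_mult_left comm_mult_right comm_pow_left
           comm_pow_right C_def log_pow)
    fix u v assume uv: "u \<in> ?D" "v \<in> ?D" "f u = f v"
    obtain i j c i' j' c' where e: "u = ((i, j), c)" "v = ((i', j'), c')" by (metis surj_pair)
    then have "i = i'" "j = j'"
      using uv coords[of i j c] coords[of i' j' c'] by (auto simp: f_def)
    then show "u = v" using uv e by (auto simp: f_def C_in_H)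
  qed
  moreover have "f ` ?D = H"
  proof
    show "f ` ?D \<subseteq> H" by (auto simp: f_def C_in_H)
    show "H \<subseteq> f ` ?D"
    proof
      fix g assume g: "g \<in> H"
      then have "g = f ((xcoord g, ycoord g), C_part g)"
        using decompose by (simp add: f_def plane_part_def)
      moreover have "((xcoord g, ycoord g), C_part g) \<in> ?D"
        using g by (simp add: xcoord_def ycoord_def log_less comm_in_Z)
      ultimately show "g \<in> f ` ?D" by (rule image_eqI)
    qed
  qed
  ultimately have "card H = card ?D" using card_image by metis
  then show ?thesis by (simp add: card_cartesian_product)
qed

text \<open>
  An element of \<open>C\<close> commutes with \<open>x\<close> and \<open>y\<close>. If it also commutes with \<open>C\<close>, then it commutes with
  every normal form, hence with \<open>H\<close>.
\<close>

lemma C_centre: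
  assumes H_centre: "\<And>w. w \<in> H \<Longrightarrow> (\<And>h. h \<in> H \<Longrightarrow> w \<otimes> h = h \<otimes> w) \<Longrightarrow> w \<in> Z"
    and "w \<in> C" "\<And>c. c \<in> C \<Longrightarrow> w \<otimes> c = c \<otimes> w"
  shows "w \<in> Z"
proof (rule H_centre)
  show wH: "w \<in> H" using assms(2) by (rule C_in_H)
  fix h assume h: "h \<in> H"
  have [simp]: "C_part h \<in> H" using C_part_C[OF h] by (rule C_in_H)
  have "w \<otimes> (plane_part h \<otimes> C_part h) = plane_part h \<otimes> (w \<otimes> C_part h)"
    using wH C_commutes(3)[OF assms(2), of h] by (simp flip: m_assoc)
  also have "\<dots> = plane_part h \<otimes> C_part h \<otimes> w"
    using wH h by (simp add: assms(3) m_assoc)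
  finally show "w \<otimes> h = h \<otimes> w" using decompose[OF h] by simp
qed

lemma C_part_Z: "z \<in> Z \<Longrightarrow> C_part z = z"
  using coords_Z[of z] by (simp add: C_part_def plane_part_def)

text \<open>
  Multiplying two normal forms leaves a central factor of two origins: moving \<open>y\<close>-powers past
  \<open>x\<close>-powers gives the commutator term, and reducing the exponents modulo \<open>p\<close> gives \<open>p\<close>-th powers
  of \<open>x\<close> and \<open>y\<close>.
\<close>

lemma C_part_mult:
  assumes g: "g \<in> H" and h: "h \<in> H"
  defines "w \<equiv> comm y x [^] (ycoord g * xcoord h) \<otimes>
                ((x [^] p) [^] ((xcoord g + xcoord h) div p) \<otimes>
                 (y [^] p) [^] ((ycoord g + ycoord h) div p))"
  shows "C_part (g \<otimes> h) = w \<otimes> (C_part g \<otimes> C_part h)"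
proof -
  define i j i' j' where ij: "i = xcoord g" "j = ycoord g" "i' = xcoord h" "j' = ycoord h"
  define a b where ab: "a = (x [^] p) [^] ((i + i') div p)" "b = (y [^] p) [^] ((j + j') div p)"
  have [simp]: "C_part g \<in> carrier G" "C_part h \<in> carrier G" "plane_part u \<in> carrier G" for u
    using g h by (auto intro!: H_carrier C_in_H)
  have Z [simp]: "a \<in> Z" "b \<in> Z" "comm y x \<in> Z"
    by (simp_all add: ab pow_in_Z comm_in_Z)
  have w: "w = comm y x [^] (j * i') \<otimes> (a \<otimes> b)" by (simp add: w_def ij ab)
  have wZ [simp]: "w \<in> Z" by (simp add: w)
  have x: "x [^] i \<otimes> x [^] i' = a \<otimes> x [^] ((i + i') mod p)"
    by (simp add: ab nat_pow_mult nat_pow_pow)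
  have y: "y [^] j \<otimes> y [^] j' = b \<otimes> y [^] ((j + j') mod p)"
    by (simp add: ab nat_pow_mult nat_pow_pow)
  have xy: "y [^] j \<otimes> x [^] i' = comm y x [^] (j * i') \<otimes> (x [^] i' \<otimes> y [^] j)"
    using comm_swap[of "y [^] j" "x [^] i'"]
    by (simp add: comm_pow_left comm_pow_right nat_pow_pow)
  have "plane_part g \<otimes> plane_part h = x [^] i \<otimes> (y [^] j \<otimes> x [^] i') \<otimes> y [^] j'"
    by (simp add: plane_part_def ij m_assoc)
  also have "\<dots> = comm y x [^] (j * i') \<otimes> ((x [^] i \<otimes> x [^] i') \<otimes> (y [^] j \<otimes> y [^] j'))"
    unfolding xy
    using Z_left_commute[of "comm y x [^] (j * i')" "x [^] i" "x [^] i' \<otimes> (y [^] j \<otimes> y [^] j')"]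
    by (simp add: m_assoc)
  also have "\<dots> = w \<otimes> (x [^] ((i + i') mod p) \<otimes> y [^] ((j + j') mod p))"
    unfolding x y w
    using Z_left_commute[of b "x [^] ((i + i') mod p)" "y [^] ((j + j') mod p)"]
    by (simp add: m_assoc)
  also have "\<dots> = w \<otimes> plane_part (g \<otimes> h)"
    using g h by (simp add: plane_part_def coords_mult ij)
  finally have plane: "plane_part g \<otimes> plane_part h = w \<otimes> plane_part (g \<otimes> h)" .
  have "g \<otimes> h = (plane_part g \<otimes> C_part g) \<otimes> (plane_part h \<otimes> C_part h)"
    using decompose g h by simp
  also have "\<dots> = plane_part g \<otimes> (C_part g \<otimes> plane_part h) \<otimes> C_part h"
    by (simp add: m_assoc)
  also have "\<dots> = (plane_part g \<otimes> plane_part h) \<otimes> (C_part g \<otimes> C_part h)"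
    using C_commutes(3)[OF C_part_C[OF g], of h] by (simp add: m_assoc)
  also have "\<dots> = plane_part (g \<otimes> h) \<otimes> (w \<otimes> (C_part g \<otimes> C_part h))"
    unfolding plane
    using Z_left_commute[of w "plane_part (g \<otimes> h)" "C_part g \<otimes> C_part h"] by (simp add: m_assoc)
  finally show ?thesis
    using inv_solve_left'[of "w \<otimes> (C_part g \<otimes> C_part h)" "plane_part (g \<otimes> h)" "g \<otimes> h"] g h
    by (simp add: C_part_def)
qed

text \<open>
  Put \<open>\<theta>' (x\<^sup>i y\<^sup>j c) = \<xi>\<^sup>i \<eta>\<^sup>j \<theta> c\<close> for \<open>p\<close>-th roots \<open>\<xi>\<close> and \<open>\<eta>\<close> of the values
  of \<open>lam\<close> at \<open>x\<^sup>p\<close> and \<open>y\<^sup>p\<close>. With this choice the carries in the exponents cancel, so that of the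
  central factor in the product of two normal forms only the commutator term
  \<open>lam (comm y x) ^ (j * i')\<close> survives. It is one further cup product.
\<close>

lemma splits_cocycle_extend:
  assumes C: "splits_cocycle n C \<theta> \<gamma> b"
  shows "\<exists>\<theta> \<gamma> b. splits_cocycle (Suc n) H \<theta> \<gamma> b"
proof -
  have C\<theta>: "\<theta> (g \<otimes> h) = \<theta> g * \<theta> h * (\<Prod>i<n. \<gamma> i g ^ b i h)" if "g \<in> C" "h \<in> C" for g h
    using C that by (simp add: splits_cocycle_def)
  have C\<gamma>: "\<gamma> i (g \<otimes> h) = \<gamma> i g * \<gamma> i h" "b i (g \<otimes> h) mod p = (b i g + b i h) mod p"
    if "g \<in> C" "h \<in> C" "i < n" for i g h
    using C that by (simp_all add: splits_cocycle_def)
  have CZ: "\<theta> z = lam z" "i < n \<Longrightarrow> \<gamma> i z = 1" "i < n \<Longrightarrow> b i z = 0" if "z \<in> Z" for z i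
    using C that by (simp_all add: splits_cocycle_def)
  have C_mult: "c \<otimes> c' \<in> C" if "c \<in> C" "c' \<in> C" for c c'
    using subgroup.m_closed[OF C_subgroup that] .
  have Z_twist: "\<theta> (z \<otimes> c) = lam z * \<theta> c" "i < n \<Longrightarrow> \<gamma> i (z \<otimes> c) = \<gamma> i c"
    "i < n \<Longrightarrow> b i (z \<otimes> c) mod p = b i c mod p" if "z \<in> Z" "c \<in> C" for z c i
    using that Z_le_C by (auto simp: C\<theta> C\<gamma> CZ subset_iff)
  have root: "\<exists>\<xi>. \<xi> ^ p = a" for a :: complex
  proof (cases "a = 0")
    case True
    then show ?thesis using p_gt_0 by (intro exI[of _ 0]) simp
  next
    case False
    then have "card {\<xi>. \<xi> ^ p = a} = p" by (rule card_nth_roots[OF _ p_gt_0])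
    then show ?thesis using p_gt_0 by (cases "{\<xi>. \<xi> ^ p = a} = {}") auto
  qed
  obtain \<xi> \<eta> where \<xi>: "\<xi> ^ p = lam (x [^] p)" and \<eta>: "\<eta> ^ p = lam (y [^] p)"
    using root by metis
  define \<mu> where "\<mu> = lam (comm y x)"
  have \<mu>: "\<mu> ^ p = 1" by (simp add: \<mu>_def lam_pow_p comm_in_Z)
  \<comment> \<open>Splitting an exponent into its residue and its carry.\<close>
  have modp: "a ^ k = (a ^ p) ^ (k div p) * a ^ (k mod p)" for a :: complex and k
    by (simp flip: power_mult power_add)
  define \<theta>' where "\<theta>' g = \<xi> ^ xcoord g * \<eta> ^ ycoord g * \<theta> (C_part g)" for g
  define \<gamma>' where "\<gamma>' i g = (if i = n then \<mu> ^ ycoord g else \<gamma> i (C_part g))" for i g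
  define b' where "b' i g = (if i = n then xcoord g else b i (C_part g))" for i g
  have "splits_cocycle (Suc n) H \<theta>' \<gamma>' b'"
    unfolding splits_cocycle_def
  proof (intro conjI ballI allI impI)
    fix g h assume g: "g \<in> H" and h: "h \<in> H"
    define i j i' j' where ij: "i = xcoord g" "j = ycoord g" "i' = xcoord h" "j' = ycoord h"
    define w where "w = comm y x [^] (j * i') \<otimes>
      ((x [^] p) [^] ((i + i') div p) \<otimes> (y [^] p) [^] ((j + j') div p))"
    have Z: "x [^] p \<in> Z" "y [^] p \<in> Z" "comm y x \<in> Z"
      by (simp_all add: pow_in_Z comm_in_Z)
    then have wZ: "w \<in> Z" by (simp add: w_def)
    have split: "C_part (g \<otimes> h) = w \<otimes> (C_part g \<otimes> C_part h)"
      unfolding w_def ij by (rule C_part_mult[OF g h])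
    have lam_w: "lam w = \<mu> ^ (j * i') * ((\<xi> ^ p) ^ ((i + i') div p) * (\<eta> ^ p) ^ ((j + j') div p))"
      using Z by (simp add: w_def lam_mult lam_pow \<xi> \<eta> \<mu>_def)
    have "\<theta>' (g \<otimes> h) = \<xi> ^ ((i + i') mod p) * \<eta> ^ ((j + j') mod p) *
        (lam w * \<theta> (C_part g \<otimes> C_part h))"
      using g h by (simp add: \<theta>'_def coords_mult ij split Z_twist wZ C_mult)
    also have "\<dots> = \<xi> ^ (i + i') * \<eta> ^ (j + j') * \<mu> ^ (j * i') * \<theta> (C_part g \<otimes> C_part h)"
      unfolding lam_w modp[of \<xi> "i + i'"] modp[of \<eta> "j + j'"] by (simp only: ac_simps)
    also have "\<dots> = \<theta>' g * \<theta>' h * (\<Prod>k<Suc n. \<gamma>' k g ^ b' k h)"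
      using g h by (simp add: \<theta>'_def \<gamma>'_def b'_def C\<theta> ij power_add ac_simps
          flip: power_mult)
    finally show "\<theta>' (g \<otimes> h) = \<theta>' g * \<theta>' h * (\<Prod>k<Suc n. \<gamma>' k g ^ b' k h)" .
    fix k assume k: "k < Suc n"
    have "\<mu> ^ ((j + j') mod p) = \<mu> ^ (j + j')"
      using modp[of \<mu> "j + j'"] \<mu> by simp
    then show "\<gamma>' k (g \<otimes> h) = \<gamma>' k g * \<gamma>' k h"
      using g h k by (simp add: \<gamma>'_def coords_mult ij split Z_twist wZ C_mult C\<gamma> power_add)
    show "b' k (g \<otimes> h) mod p = (b' k g + b' k h) mod p"
      using g h k by (simp add: b'_def coords_mult split Z_twist wZ C_mult C\<gamma>)
  next
    fix k g assume "k < Suc n" "g \<in> H"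
    moreover have "(\<mu> ^ l) ^ p = 1" for l
      by (metis \<mu> mult.commute power_mult power_one)
    ultimately show "\<gamma>' k g ^ p = 1"
      using C C_part_C[of g] by (auto simp: \<gamma>'_def splits_cocycle_def)
  next
    fix z k assume z: "z \<in> Z"
    then show "\<theta>' z = lam z" by (simp add: \<theta>'_def coords_Z C_part_Z CZ)
    assume "k < Suc n"
    then show "\<gamma>' k z = 1" "b' k z = 0"
      using z by (auto simp: \<gamma>'_def b'_def coords_Z C_part_Z CZ)
  qed
  then show ?thesis by blast
qed

end

context heisenberg_type
begin

text \<open>
  Each hyperbolic pair divides the order by \<open>p\<^sup>2\<close> and contributes one cup product. Since \<open>Z\<close> remains
  the full centre, pairs exist until the subgroup has shrunk to \<open>Z\<close>, where \<open>lam\<close> itself is the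
  required function.
\<close>

lemma splits_cocycle_exists:
  assumes "subgroup H G" "Z \<subseteq> H" "card H = p ^ (1 + 2 * n)"
    and "\<And>w. w \<in> H \<Longrightarrow> (\<And>h. h \<in> H \<Longrightarrow> w \<otimes> h = h \<otimes> w) \<Longrightarrow> w \<in> Z"
  shows "\<exists>\<theta> \<gamma> b. splits_cocycle n H \<theta> \<gamma> b"
  using assms
proof (induction n arbitrary: H)
  case 0
  have "card H = card Z" using 0(3) card_Z by simp
  moreover from this have "finite H" using card_Z p_gt_0 card_gt_0_iff[of H] by simp
  ultimately have "H = Z" using card_subset_eq[of H Z] 0(2) by simp
  then have "splits_cocycle 0 H lam (\<lambda>_ _. 1) (\<lambda>_ _. 0)"
    by (simp add: splits_cocycle_def lam_mult)
  then show ?case by blast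
next
  case (Suc n)
  have "p > 1" using prime_p by (rule prime_gt_1_nat)
  then have "p ^ (1 + 2 * Suc n) > p ^ 1" by (intro power_strict_increasing) auto
  then have "H \<noteq> Z" using Suc.prems(3) card_Z by auto
  then obtain x where x: "x \<in> H" "x \<notin> Z" using Suc.prems(2) by blast
  then obtain y where y: "y \<in> H" "x \<otimes> y \<noteq> y \<otimes> x" using Suc.prems(4) by blast
  have car: "H \<subseteq> carrier G" using Suc.prems(1) by (rule subgroup.subset)
  have "comm x y \<noteq> \<one>" using comm_eq_one_iff[of x y] x(1) y car by blast
  then interpret hyperbolic_pair G p Z lam H x y
    by (intro hyperbolic_pair.intro hyperbolic_pair_axioms.intro heisenberg_type_axioms
          Suc.prems(1,2) x(1) y(1))
  have "card C = p ^ (1 + 2 * n)"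
    using card_H Suc.prems(3) p_gt_0 by simp
  then have "\<exists>\<theta> \<gamma> b. splits_cocycle n C \<theta> \<gamma> b"
    using Suc.IH[OF C_subgroup Z_le_C _ C_centre[OF Suc.prems(4)]] by blast
  then show ?case using splits_cocycle_extend by blast
qed

end

section \<open>The monomial action on a Segre cone\<close>

text \<open>
  The coordinates \<open>x\<^sub>i\<^sub>j / x\<^sub>i\<^sub>0\<close> of the \<open>i\<close>-th projective space, extended periodically in \<open>j\<close>.
  They occupy block \<open>i\<close> of \<open>p\<close> consecutive variables except for its first one, which would stand
  for \<open>x\<^sub>i\<^sub>0 / x\<^sub>i\<^sub>0 = 1\<close>. These spare variables make the index arithmetic uniform: the first of
  them is used as fibre coordinate, and \<open>G\<close> fixes the others.
\<close>

definition affine_coord :: "nat \<Rightarrow> nat \<Rightarrow> nat \<Rightarrow> cratfun" where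
  "affine_coord p i j = (if j mod p = 0 then 1 else ratvar (p * i + j mod p))"

lemma affine_coord_nonzero [simp]: "affine_coord p i j \<noteq> 0"
  by (simp add: affine_coord_def)

lemma affine_coord_cong: "j mod p = k mod p \<Longrightarrow> affine_coord p i j = affine_coord p i k"
  by (simp add: affine_coord_def)

lemma block_index_less: "i < n \<Longrightarrow> j < p \<Longrightarrow> p * i + j < p * n" for p :: nat
  by (metis add.commute add_less_cancel_left less_le_trans mult_Suc_right mult_le_mono2 Suc_leI)

lemma affine_coord_in_ratfuns:
  assumes "p > 0" "i < n"
  shows "affine_coord p i j \<in> ratfuns (p * n)"
  using assms const_ratfun_in_ratfuns[of 1 "p * n"]
  by (auto simp: affine_coord_def intro!: ratvar_in_ratfuns block_index_less)

text \<open>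
  The shifts of the \<open>u\<close>-coordinates compose without any correction, as \<open>\<gamma> i g\<close> is a \<open>p\<close>-th root of
  unity. For the fibre coordinate, substituting the action of \<open>g\<close> into the factor
  \<open>u\<^sub>i\<^sub>,\<^sub>b\<close> with \<open>b = b i h\<close> produces the constant \<open>\<gamma> i g ^ b i h\<close>, and the product of these
  constants is the defect in the multiplicativity of \<open>\<theta>\<close>. The action is faithful: a normal subgroup
  that acts trivially contains the commutators of its elements with all of \<open>G\<close>. These lie in \<open>Z\<close>,
  on which the fibre coordinate is scaled by the faithful character \<open>lam\<close>, so they are trivial and
  the elements themselves lie in \<open>Z\<close>.
\<close>

lemma (in heisenberg_type) crd_le_of_splits_cocycle:
  assumes n: "n \<ge> 1" and split: "splits_cocycle n (carrier G) \<theta> \<gamma> b"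
    and centre: "\<And>w. w \<in> carrier G \<Longrightarrow> (\<And>h. h \<in> carrier G \<Longrightarrow> w \<otimes> h = h \<otimes> w) \<Longrightarrow> w \<in> Z"
  shows "crd G \<le> enat (p * n)"
proof -
  have \<theta>: "\<theta> (g \<otimes> h) = \<theta> g * \<theta> h * (\<Prod>i<n. \<gamma> i g ^ b i h)"
    and \<gamma>: "i < n \<Longrightarrow> \<gamma> i (g \<otimes> h) = \<gamma> i g * \<gamma> i h"
    and \<gamma>_p: "i < n \<Longrightarrow> \<gamma> i g ^ p = 1"
    and b: "i < n \<Longrightarrow> b i (g \<otimes> h) mod p = (b i g + b i h) mod p"
    if "g \<in> carrier G" "h \<in> carrier G" for g h i
    using split that by (simp_all add: splits_cocycle_def)
  have Z: "\<theta> z = lam z" "i < n \<Longrightarrow> \<gamma> i z = 1" "i < n \<Longrightarrow> b i z = 0" if "z \<in> Z" for z i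
    using split that by (simp_all add: splits_cocycle_def)
  have \<gamma>_mod: "\<gamma> i g ^ (j mod p) = \<gamma> i g ^ j" if "g \<in> carrier G" "i < n" for g i j
  proof -
    have "\<gamma> i g ^ j = (\<gamma> i g ^ p) ^ (j div p) * \<gamma> i g ^ (j mod p)"
      by (simp flip: power_mult power_add)
    then show ?thesis using \<gamma>_p that by simp
  qed
  let ?u = "affine_coord p"
  define act where "act g i j = const_ratfun (\<gamma> i g ^ j) * ?u i (j + b i g) / ?u i (b i g)" for g i j
  define s where "s g l =
    (if l = 0 then const_ratfun (\<theta> g) * ratvar 0 * (\<Prod>i<n. ?u i (b i g))
     else if l < p * n \<and> l mod p \<noteq> 0 then act g (l div p) (l mod p)
     else ratvar l)" for g l
  have act_mod: "act g i (j mod p) = act g i j" if "g \<in> carrier G" "i < n" for g i j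
  proof -
    have "?u i (j mod p + b i g) = ?u i (j + b i g)"
      by (rule affine_coord_cong) (rule mod_add_left_eq)
    then show ?thesis using \<gamma>_mod[OF that] by (simp add: act_def)
  qed
  have u_act: "specializes (s g) (?u i j) (act g i j)" if g: "g \<in> carrier G" and i: "i < n" for g i j
  proof (cases "j mod p = 0")
    case True
    then have "act g i j = 1"
      using act_mod[OF g i, of j] by (simp add: act_def)
    then show ?thesis
      using True specializes_const[of "s g" 1] by (simp add: affine_coord_def)
  next
    case False
    have "p * i + j mod p < p * n" using i p_gt_0 by (intro block_index_less) auto
    then have "s g (p * i + j mod p) = act g i j"
      using False p_gt_0 act_mod[OF g i] by (simp add: s_def)
    then show ?thesis
      using False specializes_ratvar[of "s g" "p * i + j mod p"] by (simp add: affine_coord_def)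
  qed
  have act_nonzero: "act g i j \<noteq> 0" if "g \<in> carrier G" "i < n" for g i j
  proof -
    have "\<gamma> i g \<noteq> 0" using \<gamma>_p[OF that(1,1,2)] p_gt_0 by (auto simp: power_0_left)
    then have "const_ratfun (\<gamma> i g ^ j) \<noteq> const_ratfun 0" by (simp only: const_ratfun_eq_iff) simp
    then show ?thesis by (simp add: act_def)
  qed
  have u_b: "?u i (j + b i (g \<otimes> h)) = ?u i (j + b i h + b i g)"
    if "g \<in> carrier G" "h \<in> carrier G" "i < n" for g h i j
    using b[OF that] by (intro affine_coord_cong) (metis add.assoc add.commute mod_add_right_eq)
  have s_one: "s \<one> l = ratvar l" for l
  proof -
    have "l div p < n" if "l < p * n" using that by (simp add: less_mult_imp_div_less mult.commute)
    moreover have "?u i 0 = 1" for i by (simp add: affine_coord_def)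
    ultimately show ?thesis
      using Z[OF Z_one] by (auto simp: s_def act_def lam_one affine_coord_def)
  qed
  have s_mult: "specializes (s g) (s h l) (s (g \<otimes> h) l)"
    if g: "g \<in> carrier G" and h: "h \<in> carrier G" for g h l
  proof -
    consider "l = 0" | "l \<noteq> 0" "l < p * n \<and> l mod p \<noteq> 0" | "l \<noteq> 0" "\<not> (l < p * n \<and> l mod p \<noteq> 0)"
      by blast
    then show ?thesis
    proof cases
      case 1
      have "specializes (s g) (s h 0) (const_ratfun (\<theta> h) * s g 0 * (\<Prod>i<n. act g i (b i h)))"
        unfolding s_def[of h 0] using g
        by (auto intro!: specializes_mult specializes_const specializes_ratvar specializes_prod u_act)
      also have "const_ratfun (\<theta> h) * s g 0 * (\<Prod>i<n. act g i (b i h)) =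
          const_ratfun (\<theta> g * \<theta> h * (\<Prod>i<n. \<gamma> i g ^ b i h)) * ratvar 0 *
            (\<Prod>i<n. ?u i (b i h + b i g))"
        by (simp add: s_def act_def prod.distrib prod_dividef const_ratfun_mult const_ratfun_prod)
      also have "\<dots> = s (g \<otimes> h) 0"
        using \<theta>[OF g h] u_b[OF g h, of _ 0] by (simp add: s_def)
      finally show ?thesis using 1 by simp
    next
      case 2
      define i j where ij: "i = l div p" "j = l mod p"
      have i: "i < n" using 2 by (simp add: ij less_mult_imp_div_less mult.commute)
      have "specializes (s g) (act h i j)
          (const_ratfun (\<gamma> i h ^ j) * act g i (j + b i h) / act g i (b i h))"
        unfolding act_def[of h]
        by (intro specializes_mult specializes_divide specializes_const u_act act_nonzero g i)
      also have "const_ratfun (\<gamma> i h ^ j) * act g i (j + b i h) / act g i (b i h) =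
          const_ratfun (\<gamma> i (g \<otimes> h) ^ j) * ?u i (j + b i h + b i g) / ?u i (b i h + b i g)"
        using act_nonzero[OF g i, of "b i h"] \<gamma>[OF g h i]
        by (simp add: act_def power_add power_mult_distrib const_ratfun_mult)
      also have "\<dots> = act (g \<otimes> h) i j"
        using u_b[OF g h i, of j] u_b[OF g h i, of 0] by (simp add: act_def)
      finally have "specializes (s g) (act h i j) (act (g \<otimes> h) i j)" .
      moreover have "s k l = act k i j" for k using 2 by (simp add: s_def ij)
      ultimately show ?thesis by simp
    next
      case 3
      then have fixed: "s k l = ratvar l" for k unfolding s_def by (simp only: if_False)
      show ?thesis using specializes_ratvar[of "s g" l] unfolding fixed .
    qed
  qed
  have s_closed: "s g l \<in> ratfuns (p * n)" if l: "l < p * n" for g l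
  proof -
    have "l div p < n" using l by (simp add: less_mult_imp_div_less mult.commute)
    then show ?thesis
      using l n p_gt_0 unfolding s_def act_def
      by (auto intro!: ratfuns_mult ratfuns_divide ratfuns_prod const_ratfun_in_ratfuns
            ratvar_in_ratfuns affine_coord_in_ratfuns)
  qed
  have faithful_Z: "z = \<one>" if z: "z \<in> Z" and s: "s z 0 = ratvar 0" for z
  proof -
    have "?u i 0 = 1" for i by (simp add: affine_coord_def)
    then have "const_ratfun (\<theta> z) = const_ratfun 1"
      using s Z[OF z] by (simp add: s_def)
    then show ?thesis using lam_faithful[OF z] Z(1)[OF z] by (simp only: const_ratfun_eq_iff)
  qed
  have faithful: "g = \<one>" if g: "g \<in> carrier G" and fixed: "\<And>l. l < p * n \<Longrightarrow> s g l = ratvar l" for g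
  proof -
    have sg: "s g = ratvar"
    proof
      show "s g l = ratvar l" for l
        using fixed n p_gt_0 by (cases "l < p * n") (auto simp: s_def)
    qed
    have "g \<in> Z"
    proof (rule centre[OF g])
      fix h assume h: "h \<in> carrier G"
      \<comment> \<open>As \<open>g\<close> acts trivially, \<open>g \<otimes> h\<close> and \<open>h \<otimes> g\<close> act alike, so the commutator acts trivially.\<close>
      have "s (g \<otimes> h) l = s h l" "s (h \<otimes> g) l = s h l" for l
        using s_mult[OF g h, of l] s_mult[OF h g, of l] specializes_by_ratvar specializes_ratvar
        unfolding sg by (blast intro: specializes_unique)+
      then have same: "s (g \<otimes> h) = s (h \<otimes> g)" by auto
      have "s (g \<otimes> h \<otimes> inv (h \<otimes> g)) 0 = s (h \<otimes> g \<otimes> inv (h \<otimes> g)) 0"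
        using s_mult[of "g \<otimes> h" "inv (h \<otimes> g)" 0] s_mult[of "h \<otimes> g" "inv (h \<otimes> g)" 0] g h
        unfolding same by (auto intro: specializes_unique)
      moreover have "g \<otimes> h \<otimes> inv (h \<otimes> g) = comm g h" "h \<otimes> g \<otimes> inv (h \<otimes> g) = \<one>"
        using g h by (simp_all add: r_inv[of "h \<otimes> g"]) (simp add: comm_def inv_mult_group m_assoc)
      ultimately have "s (comm g h) 0 = ratvar 0" by (simp add: s_one)
      then have "comm g h = \<one>" using faithful_Z comm_in_Z[OF g h] by blast
      then show "g \<otimes> h = h \<otimes> g" using comm_eq_one_iff[OF g h] by blast
    qed
    then show "g = \<one>" using faithful_Z sg by simp
  qed
  show ?thesis
    by (rule crd_le_of_substitution_action[OF is_group, of s])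
       (use s_one s_mult s_closed faithful in auto)
qed

section \<open>Extraspecial groups\<close>

theorem proposition5p1:
  fixes G (structure) and p n :: nat
  assumes "Factorial_Ring.prime p" and "n \<ge> 1"
    and "extraspecial p G" and "order G = p ^ (1 + 2 * n)"
  shows "crd G \<le> enat (p * n)"
proof -
  let ?Z = "center G"
  have es: "group G" "card ?Z = p" "?Z = derived G (carrier G)" "elementary_abelian p (G Mod ?Z)"
    using assms(3) by (auto simp: extraspecial_def finite_p_group_def)
  interpret group G by (rule es(1))
  have central: "z \<in> ?Z \<Longrightarrow> g \<in> carrier G \<Longrightarrow> z \<otimes> g = g \<otimes> z" for z g
    by (simp add: center_def)
  interpret Z: normal ?Z G
    unfolding es(3) by (rule derived_self_is_normal)
  have "\<exists>lam :: 'a \<Rightarrow> complex. (\<forall>z\<in>?Z. \<forall>w\<in>?Z. lam (z \<otimes> w) = lam z * lam w) \<and> lam \<one> = 1 \<and>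
      (\<forall>z\<in>?Z. lam z = 1 \<longrightarrow> z = \<one>)"
    by (rule faithful_character_exists[OF Z.subgroup_axioms es(2) assms(1)])
  then obtain lam :: "'a \<Rightarrow> complex" where lam:
    "\<And>z w. z \<in> ?Z \<Longrightarrow> w \<in> ?Z \<Longrightarrow> lam (z \<otimes> w) = lam z * lam w" "lam \<one> = 1"
    "\<And>z. z \<in> ?Z \<Longrightarrow> lam z = 1 \<Longrightarrow> z = \<one>"
    by blast
  interpret heisenberg_type G p ?Z lam
  proof unfold_locales
    fix g h assume "g \<in> carrier G" "h \<in> carrier G"
    then show "comm g h \<in> ?Z"
      unfolding es(3) comm_def derived_def by (intro generate.incl) blast
  next
    fix g assume g: "g \<in> carrier G"
    then have "?Z #> g \<in> carrier (G Mod ?Z)" by (simp add: carrier_FactGroup)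
    then have "(?Z #> g) [^]\<^bsub>G Mod ?Z\<^esub> p = ?Z"
      using es(4) by (simp add: elementary_abelian_def)
    then have "?Z #> g [^] p = ?Z"
      by (simp only: Z.FactGroup_pow[OF g])
    then show "g [^] p \<in> ?Z"
      using g rcos_self[OF _ Z.subgroup_axioms, of "g [^] p"] by simp
  qed (use assms(1) es(2) lam central in auto)
  have centre: "w \<in> ?Z" if "w \<in> carrier G" "\<And>h. h \<in> carrier G \<Longrightarrow> w \<otimes> h = h \<otimes> w" for w
    using that unfolding center_def by blast
  have "card (carrier G) = p ^ (1 + 2 * n)"
    using assms(4) by (simp add: Coset.order_def)
  then obtain \<theta> \<gamma> b where "splits_cocycle n (carrier G) \<theta> \<gamma> b"
    using splits_cocycle_exists[OF subgroup_self Z.subset _ centre] by blast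
  then show ?thesis
    by (rule crd_le_of_splits_cocycle[OF assms(2) _ centre])
qed

end
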